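(* The first-order theory $VW^*$ interprets the first-order theory $WD_R$ (both defined in the context).
   Context: "Interprets" refers to (relative) formal interpretability in the usual sense. Both theories include the usual axioms for identity. $WD_R$: $B^*$ is the set of nonempty finite strings of 0's and 1's, $^\frown$ is concatenation, and $s\sqsubseteq t$ between strings means $s$ is a (nonempty, possibly improper) initial segment of $t$. The vocabulary has a constant $\underline{s}$ for each $s\in B^*$, a binary relation symbol $\preccurlyeq$ and a ternary relation symbol $C$. Axioms: (1) $C(\underline{s},\underline{t},\underline{s^\frown t})$ for $s,t\in B^*$; (2) $\neg(\underline{s}=\underline{t})$ for distinct $s,t\in B^*$; (3) $\forall x(x\preccurlyeq\underline{t}\leftrightarrow\bigvee_{s\sqsubseteq t}x=\underline{s})$ for $t\in B^*$; (4) $\forall x,y\,\exists z\,C(x,y,z)$; (5) $\forall x,y,u,v\,(C(x,y,u)\ \&\ C(x,y,v)\to u=v)$. $VW^*$: $\Sigma^*$ is the set of finite words over $\{1,2\}$, including the empty word $e$. Signature $\{\underline{e},S_1,S_2,S_3,S_4,\sqsubseteq,\sqsupseteq\}$ ($\underline{e}$ a constant, $S_i$ unary functions, $\sqsubseteq,\sqsupseteq$ binary relations). The canonical term of $e$ is $\underline{e}$, and $\underline{w^\frown d}$ is $S_d(\underline{w})$ for $d\in\{1,2\}$. Axioms: (VW1) $\neg\,\underline{s}=\underline{t}$ for distinct $s,t\in\Sigma^*$; (VW2) $S_d(\underline{t})=\underline{t^\frown d}$ for $t\in\Sigma^*$, $d=1,2$; (VW3) $\underline{e}\sqsubseteq\underline{t}$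 for $t\in\Sigma^*$; (VW4) $\forall x(x\sqsubseteq\underline{e}\to x=\underline{e})$; (VW5) $\forall x(x\sqsubseteq S_d(\underline{t})\leftrightarrow x\sqsubseteq\underline{t}\vee x=S_d(\underline{t}))$ for $t\in\Sigma^*$, $d=1,2$; (VW2* ) $S_3(\underline{t})=\underline{1^\frown t}$ and $S_4(\underline{t})=\underline{2^\frown t}$ for $t\in\Sigma^*$; (VW3* ) $\underline{e}\sqsupseteq\underline{t}$ for $t\in\Sigma^*$; (VW4* ) $\forall x(x\sqsupseteq\underline{e}\to x=\underline{e})$; (VW5* ) $\forall x(x\sqsupseteq S_d(\underline{t})\leftrightarrow x\sqsupseteq\underline{t}\vee x=S_d(\underline{t}))$ for $t\in\Sigma^*$, $d=3,4$; (VW10) $\forall x,y(x\sqsubseteq y\ \&\ y\sqsubseteq x\to x=y)$. *)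

theory Defs
  imports Main "HOL-Library.Sublist"
begin

section \<open>First-order logic with identity\<close>

text \<open>Variables are de Bruijn indices: \<open>Var 0\<close> refers to the innermost enclosing quantifier, and
  an index exceeding the number of enclosing quantifiers denotes a free variable.\<close>

datatype 'f trm = Var nat | Fun 'f "'f trm list"

datatype ('f, 'r) fm =
    Falsum
  | Eq "'f trm" "'f trm"
  | Rel 'r "'f trm list"
  | Imp "('f, 'r) fm" "('f, 'r) fm"
  | Forall "('f, 'r) fm"

definition Neg :: "('f, 'r) fm \<Rightarrow> ('f, 'r) fm" where
  "Neg p = Imp p Falsum"

definition And :: "('f, 'r) fm \<Rightarrow> ('f, 'r) fm \<Rightarrow> ('f, 'r) fm" where
  "And p q = Neg (Imp p (Neg q))"

definition Or :: "('f, 'r) fm \<Rightarrow> ('f, 'r) fm \<Rightarrow> ('f, 'r) fm" where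
  "Or p q = Imp (Neg p) q"

definition Iff :: "('f, 'r) fm \<Rightarrow> ('f, 'r) fm \<Rightarrow> ('f, 'r) fm" where
  "Iff p q = And (Imp p q) (Imp q p)"

definition Exists :: "('f, 'r) fm \<Rightarrow> ('f, 'r) fm" where
  "Exists p = Neg (Forall (Neg p))"

definition Conj :: "('f, 'r) fm list \<Rightarrow> ('f, 'r) fm" where
  "Conj ps = foldr And ps (Neg Falsum)"

definition Disj :: "('f, 'r) fm list \<Rightarrow> ('f, 'r) fm" where
  "Disj ps = foldr Or ps Falsum"

subsection \<open>Simultaneous substitution and free variables\<close>

primrec subst_trm :: "(nat \<Rightarrow> 'f trm) \<Rightarrow> 'f trm \<Rightarrow> 'f trm" where
  "subst_trm \<sigma> (Var i) = \<sigma> i"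
| "subst_trm \<sigma> (Fun f ts) = Fun f (map (subst_trm \<sigma>) ts)"

definition push :: "(nat \<Rightarrow> 'f trm) \<Rightarrow> nat \<Rightarrow> 'f trm" where
  "push \<sigma> i = (case i of 0 \<Rightarrow> Var 0 | Suc j \<Rightarrow> subst_trm (\<lambda>k. Var (Suc k)) (\<sigma> j))"

primrec subst :: "(nat \<Rightarrow> 'f trm) \<Rightarrow> ('f, 'r) fm \<Rightarrow> ('f, 'r) fm" where
  "subst \<sigma> Falsum = Falsum"
| "subst \<sigma> (Eq s t) = Eq (subst_trm \<sigma> s) (subst_trm \<sigma> t)"
| "subst \<sigma> (Rel r ts) = Rel r (map (subst_trm \<sigma>) ts)"
| "subst \<sigma> (Imp p q) = Imp (subst \<sigma> p) (subst \<sigma> q)"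
| "subst \<sigma> (Forall p) = Forall (subst (push \<sigma>) p)"

definition lift :: "('f, 'r) fm \<Rightarrow> ('f, 'r) fm" where
  "lift p = subst (\<lambda>i. Var (Suc i)) p"

text \<open>The instance \<open>p(t)\<close> of the body \<open>p\<close> of a quantified formula.\<close>

definition inst :: "'f trm \<Rightarrow> ('f, 'r) fm \<Rightarrow> ('f, 'r) fm" where
  "inst t p = subst (\<lambda>i. case i of 0 \<Rightarrow> t | Suc j \<Rightarrow> Var j) p"

primrec fv_trm :: "'f trm \<Rightarrow> nat set" where
  "fv_trm (Var i) = {i}"
| "fv_trm (Fun f ts) = \<Union> (set (map fv_trm ts))"

primrec fv :: "('f, 'r) fm \<Rightarrow> nat set" where
  "fv Falsum = {}"
| "fv (Eq s t) = fv_trm s \<union> fv_trm t"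
| "fv (Rel r ts) = \<Union> (set (map fv_trm ts))"
| "fv (Imp p q) = fv p \<union> fv q"
| "fv (Forall p) = {i. Suc i \<in> fv p}"

text \<open>There is exactly one value of variable 0 for which \<open>p\<close> holds.\<close>

definition Exists1 :: "('f, 'r) fm \<Rightarrow> ('f, 'r) fm" where
  "Exists1 p = Exists (And p (Forall (Imp
     (subst (\<lambda>i. case i of 0 \<Rightarrow> Var 0 | Suc j \<Rightarrow> Var (Suc (Suc j))) p)
     (Eq (Var 0) (Var 1)))))"

subsection \<open>Signatures, provability, theories\<close>

text \<open>A symbol belongs to the signature iff its arity is defined; constants are function symbols
  of arity 0.\<close>

record ('f, 'r) signature =
  fun_arity :: "'f \<Rightarrow> nat option"
  rel_arity :: "'r \<Rightarrow> nat option"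

primrec wf_trm :: "('f, 'r) signature \<Rightarrow> 'f trm \<Rightarrow> bool" where
  "wf_trm L (Var i) \<longleftrightarrow> True"
| "wf_trm L (Fun f ts) \<longleftrightarrow> fun_arity L f = Some (length ts) \<and> list_all id (map (wf_trm L) ts)"

primrec wf_fm :: "('f, 'r) signature \<Rightarrow> ('f, 'r) fm \<Rightarrow> bool" where
  "wf_fm L Falsum \<longleftrightarrow> True"
| "wf_fm L (Eq s t) \<longleftrightarrow> wf_trm L s \<and> wf_trm L t"
| "wf_fm L (Rel r ts) \<longleftrightarrow> rel_arity L r = Some (length ts) \<and> list_all (wf_trm L) ts"
| "wf_fm L (Imp p q) \<longleftrightarrow> wf_fm L p \<and> wf_fm L q"
| "wf_fm L (Forall p) \<longleftrightarrow> wf_fm L p"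

text \<open>Classical natural deduction with identity, for a set of assumptions in the signature \<open>L\<close>.
  The well-formedness premises keep every formula of a derivation inside the language of \<open>L\<close>.\<close>

inductive proves :: "('f, 'r) signature \<Rightarrow> ('f, 'r) fm set \<Rightarrow> ('f, 'r) fm \<Rightarrow> bool"
  for L :: "('f, 'r) signature" where
  Assm: "p \<in> H \<Longrightarrow> proves L H p"
| ImpI: "wf_fm L p \<Longrightarrow> proves L (insert p H) q \<Longrightarrow> proves L H (Imp p q)"
| ImpE: "proves L H (Imp p q) \<Longrightarrow> proves L H p \<Longrightarrow> proves L H q"
| Raa: "wf_fm L p \<Longrightarrow> proves L (insert (Neg p) H) Falsum \<Longrightarrow> proves L H p"
| ForallI: "proves L (lift ` H) p \<Longrightarrow> proves L H (Forall p)"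
| ForallE: "wf_trm L t \<Longrightarrow> proves L H (Forall p) \<Longrightarrow> proves L H (inst t p)"
| EqRefl: "wf_trm L t \<Longrightarrow> proves L H (Eq t t)"
| EqSubst: "proves L H (Eq s t) \<Longrightarrow> proves L H (inst s p) \<Longrightarrow> proves L H (inst t p)"

record ('f, 'r) fo_theory =
  sig :: "('f, 'r) signature"
  axioms :: "('f, 'r) fm set"

section \<open>Relative interpretability\<close>

text \<open>A translation provides a domain formula \<open>\<delta>(v0)\<close>, for each n-ary relation symbol a formula
  with arguments \<open>v0, \<dots>, v(n-1)\<close>, and for each n-ary function symbol a formula defining its graph,
  with value \<open>v0\<close> and arguments \<open>v1, \<dots>, vn\<close>. Identity is translated as identity.\<close>

record ('f, 'r, 'g, 's) translation =
  dom_fm :: "('g, 's) fm"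
  fun_fm :: "'f \<Rightarrow> ('g, 's) fm"
  rel_fm :: "'r \<Rightarrow> ('g, 's) fm"

definition dom_at :: "('f, 'r, 'g, 's) translation \<Rightarrow> nat \<Rightarrow> ('g, 's) fm" where
  "dom_at \<tau> i = subst (\<lambda>_. Var i) (dom_fm \<tau>)"

text \<open>If each formula in \<open>vs\<close> says that variable 0 is the value of some term whose variables are
  shifted up by one, then \<open>with_values \<tau> k vs p\<close> says that there are elements
  \<open>v0, \<dots>, v(n-1)\<close> of the domain which are the values of these n terms and satisfy \<open>p\<close>.
  Here the term variables start at index \<open>k\<close> outside the new quantifiers.\<close>

definition with_values ::
  "('f, 'r, 'g, 's) translation \<Rightarrow> nat \<Rightarrow> ('g, 's) fm list \<Rightarrow> ('g, 's) fm \<Rightarrow> ('g, 's) fm" where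
  "with_values \<tau> k vs p =
     (let n = length vs in
      (Exists ^^ n)
        (And (Conj (map (\<lambda>i. And (dom_at \<tau> i)
                 (subst (\<lambda>m. case m of 0 \<Rightarrow> Var i | Suc j \<Rightarrow> Var (n + k + j)) (vs ! i))) [0..<n]))
             p))"

text \<open>\<open>value_fm \<tau> t\<close> says that variable 0 is the value of \<open>t\<close>, whose variables are shifted up by one.\<close>

primrec value_fm :: "('f, 'r, 'g, 's) translation \<Rightarrow> 'f trm \<Rightarrow> ('g, 's) fm" where
  "value_fm \<tau> (Var i) = Eq (Var 0) (Var (Suc i))"
| "value_fm \<tau> (Fun f ts) = with_values \<tau> 1 (map (value_fm \<tau>) ts)
     (subst (\<lambda>m. case m of 0 \<Rightarrow> Var (length ts) | Suc j \<Rightarrow> Var j) (fun_fm \<tau> f))"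

primrec translate :: "('f, 'r, 'g, 's) translation \<Rightarrow> ('f, 'r) fm \<Rightarrow> ('g, 's) fm" where
  "translate \<tau> Falsum = Falsum"
| "translate \<tau> (Eq s t) = with_values \<tau> 0 [value_fm \<tau> s, value_fm \<tau> t] (Eq (Var 0) (Var 1))"
| "translate \<tau> (Rel r ts) = with_values \<tau> 0 (map (value_fm \<tau>) ts) (rel_fm \<tau> r)"
| "translate \<tau> (Imp p q) = Imp (translate \<tau> p) (translate \<tau> q)"
| "translate \<tau> (Forall p) = Forall (Imp (dom_fm \<tau>) (translate \<tau> p))"

definition wf_translation ::
  "('g, 's) signature \<Rightarrow> ('f, 'r) signature \<Rightarrow> ('f, 'r, 'g, 's) translation \<Rightarrow> bool" where
  "wf_translation M L \<tau> \<longleftrightarrow>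
     wf_fm M (dom_fm \<tau>) \<and> fv (dom_fm \<tau>) \<subseteq> {0} \<and>
     (\<forall>f n. fun_arity L f = Some n \<longrightarrow> wf_fm M (fun_fm \<tau> f) \<and> fv (fun_fm \<tau> f) \<subseteq> {..n}) \<and>
     (\<forall>r n. rel_arity L r = Some n \<longrightarrow> wf_fm M (rel_fm \<tau> r) \<and> fv (rel_fm \<tau> r) \<subseteq> {..<n})"

text \<open>\<open>interpretation_in U T \<tau>\<close>: the translation \<open>\<tau>\<close> is an interpretation of \<open>T\<close> in \<open>U\<close>, i.e. \<open>U\<close>
  proves that the domain is nonempty, that function symbols denote operations on the domain,
  and the translations of the axioms of \<open>T\<close>.\<close>

definition interpretation_in ::
  "('g, 's) fo_theory \<Rightarrow> ('f, 'r) fo_theory \<Rightarrow> ('f, 'r, 'g, 's) translation \<Rightarrow> bool" where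
  "interpretation_in U T \<tau> \<longleftrightarrow>
     wf_translation (sig U) (sig T) \<tau> \<and>
     proves (sig U) (axioms U) (Exists (dom_fm \<tau>)) \<and>
     (\<forall>f n. fun_arity (sig T) f = Some n \<longrightarrow>
        proves (sig U) (axioms U)
          ((Forall ^^ n) (Imp (Conj (map (dom_at \<tau>) [0..<n]))
             (Exists1 (And (dom_fm \<tau>) (fun_fm \<tau> f)))))) \<and>
     (\<forall>p \<in> axioms T. proves (sig U) (axioms U) (translate \<tau> p))"

definition interprets :: "('g, 's) fo_theory \<Rightarrow> ('f, 'r) fo_theory \<Rightarrow> bool" where
  "interprets U T \<longleftrightarrow> (\<exists>\<tau>. interpretation_in U T \<tau>)"

section \<open>The theory \<open>WD_R\<close>\<close>

datatype bit = Zero | One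

datatype wd_rel = Below | C

text \<open>The function symbols are the constants for the nonempty strings, named by these strings.\<close>

definition wd_sig :: "(bit list, wd_rel) signature" where
  "wd_sig = \<lparr>fun_arity = (\<lambda>s. if s \<noteq> [] then Some 0 else None),
             rel_arity = (\<lambda>r. case r of Below \<Rightarrow> Some 2 | C \<Rightarrow> Some 3)\<rparr>"

abbreviation wd_const :: "bit list \<Rightarrow> bit list trm" where
  "wd_const s \<equiv> Fun s []"

definition wd_axioms :: "(bit list, wd_rel) fm set" where
  "wd_axioms =
     {Rel C [wd_const s, wd_const t, wd_const (s @ t)] | s t. s \<noteq> [] \<and> t \<noteq> []}
   \<union> {Neg (Eq (wd_const s) (wd_const t)) | s t. s \<noteq> [] \<and> t \<noteq> [] \<and> s \<noteq> t}
   \<union> {Forall (Iff (Rel Below [Var 0, wd_const t])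
        (Disj (map (\<lambda>s. Eq (Var 0) (wd_const s)) (filter (\<lambda>s. s \<noteq> []) (prefixes t))))) | t. t \<noteq> []}
   \<union> {Forall (Forall (Exists (Rel C [Var 2, Var 1, Var 0])))}
   \<union> {Forall (Forall (Forall (Forall
        (Imp (And (Rel C [Var 3, Var 2, Var 1]) (Rel C [Var 3, Var 2, Var 0]))
          (Eq (Var 1) (Var 0))))))}"

definition WD_R :: "(bit list, wd_rel) fo_theory" where
  "WD_R = \<lparr>sig = wd_sig, axioms = wd_axioms\<rparr>"

section \<open>The theory \<open>VW*\<close>\<close>

datatype letter = L1 | L2

datatype vw_fun = E | S1 | S2 | S3 | S4

text \<open>\<open>Pre\<close> and \<open>Suf\<close> are the symbols \<open>\<sqsubseteq>\<close> and \<open>\<sqsupseteq>\<close>; \<open>Suf\<close> takes the suffix as its first argument.\<close>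

datatype vw_rel = Pre | Suf

definition vw_sig :: "(vw_fun, vw_rel) signature" where
  "vw_sig = \<lparr>fun_arity = (\<lambda>f. if f = E then Some 0 else Some 1), rel_arity = (\<lambda>_. Some 2)\<rparr>"

definition snoc_sym :: "letter \<Rightarrow> vw_fun" where
  "snoc_sym d = (case d of L1 \<Rightarrow> S1 | L2 \<Rightarrow> S2)"

definition cons_sym :: "letter \<Rightarrow> vw_fun" where
  "cons_sym d = (case d of L1 \<Rightarrow> S3 | L2 \<Rightarrow> S4)"

abbreviation snoc_trm :: "letter \<Rightarrow> vw_fun trm \<Rightarrow> vw_fun trm" where
  "snoc_trm d t \<equiv> Fun (snoc_sym d) [t]"

abbreviation cons_trm :: "letter \<Rightarrow> vw_fun trm \<Rightarrow> vw_fun trm" where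
  "cons_trm d t \<equiv> Fun (cons_sym d) [t]"

text \<open>The canonical term of a word: \<open>canon [] = Fun E []\<close> and
  \<open>canon (w @ [d]) = snoc_trm d (canon w)\<close>.\<close>

definition canon :: "letter list \<Rightarrow> vw_fun trm" where
  "canon w = foldl (\<lambda>t d. snoc_trm d t) (Fun E []) w"

definition vw_star_axioms :: "(vw_fun, vw_rel) fm set" where
  "vw_star_axioms =
     {Neg (Eq (canon s) (canon t)) | s t. s \<noteq> t}
   \<union> {Eq (snoc_trm d (canon t)) (canon (t @ [d])) | t d. True}
   \<union> {Rel Pre [canon [], canon t] | t. True}
   \<union> {Forall (Imp (Rel Pre [Var 0, canon []]) (Eq (Var 0) (canon [])))}
   \<union> {Forall (Iff (Rel Pre [Var 0, snoc_trm d (canon t)])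
        (Or (Rel Pre [Var 0, canon t]) (Eq (Var 0) (snoc_trm d (canon t))))) | t d. True}
   \<union> {Eq (cons_trm d (canon t)) (canon (d # t)) | t d. True}
   \<union> {Rel Suf [canon [], canon t] | t. True}
   \<union> {Forall (Imp (Rel Suf [Var 0, canon []]) (Eq (Var 0) (canon [])))}
   \<union> {Forall (Iff (Rel Suf [Var 0, cons_trm d (canon t)])
        (Or (Rel Suf [Var 0, canon t]) (Eq (Var 0) (cons_trm d (canon t))))) | t d. True}
   \<union> {Forall (Forall (Imp (And (Rel Pre [Var 1, Var 0]) (Rel Pre [Var 0, Var 1]))
        (Eq (Var 1) (Var 0))))}"

definition VW_star :: "(vw_fun, vw_rel) fo_theory" where
  "VW_star = \<lparr>sig = vw_sig, axioms = vw_star_axioms\<rparr>"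

end

(*
  By completeness it suffices to work in models of VW*, where the axioms determine the prefixes and
  the suffixes of every standard word. All elements belong to the domain, and a bit string is
  interpreted by its code, a concatenation of blocks "1" and "21".

  A word w is regarded as the finite set of pairs (u, q) that occur in w as blocks, separated by the
  markers "221" and "2221". Call w good for (x, y) if this set contains (x, empty) and is closed
  under appending the same symbol to both components as long as the second one is a prefix of y.
  If x and y are standard, then every good w, standard or not, contains (xy, y), by induction along
  y, whereas a standard good word containing only the pairs (xq, q) shows that no other (z, y)
  belongs to all good w. So "(z, y) belongs to every good w" defines concatenation on standard
  words, and making z equal to x whenever this does not define a unique z gives a total function.
*)
theory Submission
  imports Defs "HOL-Library.Countable"
begin

section \<open>Composition of simultaneous substitutions on de Bruijn terms and formulas\<close>

section \<open>Substitution\<close>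

lemma subst_trm_subst_trm:
  "subst_trm \<sigma> (subst_trm \<rho> t) = subst_trm (\<lambda>i. subst_trm \<sigma> (\<rho> i)) t"
  by (induction t) auto

lemma push_comp: "subst_trm (push \<sigma>) (push \<rho> i) = push (\<lambda>i. subst_trm \<sigma> (\<rho> i)) i"
  by (cases i) (auto simp: push_def subst_trm_subst_trm)

text \<open>Binders cause no trouble because \<open>push\<close> respects composition. Later
  substitution identities thereby reduce to comparing two index maps.\<close>

lemma subst_subst: "subst \<sigma> (subst \<rho> p) = subst (\<lambda>i. subst_trm \<sigma> (\<rho> i)) p"
  by (induction p arbitrary: \<sigma> \<rho>) (auto simp: subst_trm_subst_trm push_comp)

lemma subst_trm_Var [simp]: "subst_trm Var t = t"
  by (induction t) (auto intro: map_idI)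

lemma push_Var [simp]: "push Var = Var"
  by (rule ext) (simp add: push_def split: nat.split)

lemma subst_Var [simp]: "subst Var p = p"
  by (induction p) (auto intro: map_idI)

lemma subst_trm_cong: "(\<And>i. i \<in> fv_trm t \<Longrightarrow> \<sigma> i = \<rho> i) \<Longrightarrow> subst_trm \<sigma> t = subst_trm \<rho> t"
  by (induction t) auto

lemma subst_cong_fv: "(\<And>i. i \<in> fv p \<Longrightarrow> \<sigma> i = \<rho> i) \<Longrightarrow> subst \<sigma> p = subst \<rho> p"
proof (induction p arbitrary: \<sigma> \<rho>)
  case (Forall p)
  have "subst (push \<sigma>) p = subst (push \<rho>) p"
    by (rule Forall.IH) (use Forall.prems in \<open>auto simp: push_def split: nat.split\<close>)
  then show ?case by simp
next
  case (Eq s t)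
  then show ?case by (simp add: subst_trm_cong[of _ \<sigma> \<rho>])
next
  case (Rel r ts)
  then have "subst_trm \<sigma> t = subst_trm \<rho> t" if "t \<in> set ts" for t
    using that by (intro subst_trm_cong) auto
  then show ?case by simp
next
  case (Imp p q)
  have "subst \<sigma> p = subst \<rho> p" "subst \<sigma> q = subst \<rho> q"
    by (rule Imp.IH, use Imp.prems in simp)+
  then show ?case by simp
qed simp

lemma inst_eq: "inst t p = subst (case_nat t Var) p"
  by (simp add: inst_def)

text \<open>Needed where a quantifier is opened: the quantifier case of \<open>truth\<close> can use
  its induction hypothesis at \<open>case_nat t \<sigma>\<close>.\<close>

lemma inst_push: "inst t (subst (push \<sigma>) p) = subst (case_nat t \<sigma>) p"
  unfolding inst_eq subst_subst
  by (rule arg_cong[where f = "\<lambda>s. subst s p"], rule ext)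
    (simp add: push_def subst_trm_subst_trm split: nat.split)

lemma subst_inst: "subst \<sigma> (inst t p) = inst (subst_trm \<sigma> t) (subst (push \<sigma>) p)"
  unfolding inst_push unfolding inst_eq subst_subst
  by (rule arg_cong[where f = "\<lambda>s. subst s p"], rule ext) (simp split: nat.split)

lemma subst_push_lift: "subst (push \<sigma>) (lift p) = lift (subst \<sigma> p)"
  by (simp add: lift_def subst_subst push_def)

lemma inst_shift_trm [simp]:
  "subst_trm (case_nat t Var) (subst_trm (\<lambda>i. Var (Suc i)) s) = s"
  by (simp add: subst_trm_subst_trm)

lemma wf_subst_trm: "wf_trm L t \<Longrightarrow> (\<And>i. wf_trm L (\<sigma> i)) \<Longrightarrow> wf_trm L (subst_trm \<sigma> t)"
  by (induction t) (auto simp: list_all_iff)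

lemma wf_push: "(\<And>i. wf_trm L (\<sigma> i)) \<Longrightarrow> wf_trm L (push \<sigma> i)"
  by (auto simp: push_def intro: wf_subst_trm split: nat.split)

lemma wf_subst: "wf_fm L p \<Longrightarrow> (\<And>i. wf_trm L (\<sigma> i)) \<Longrightarrow> wf_fm L (subst \<sigma> p)"
  by (induction p arbitrary: \<sigma>) (auto simp: list_all_iff wf_subst_trm wf_push)

lemma wf_inst: "wf_trm L t \<Longrightarrow> wf_fm L p \<Longrightarrow> wf_fm L (inst t p)"
  unfolding inst_eq by (rule wf_subst) (auto split: nat.split)

lemma wf_Neg [simp]: "wf_fm L (Neg p) = wf_fm L p"
  by (simp add: Neg_def)

lemma finite_fv_trm: "finite (fv_trm t)"
  by (induction t) auto

lemma finite_fv: "finite (fv p)"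
proof (induction p)
  case (Forall p)
  have "{i. Suc i \<in> fv p} = Suc -` fv p" by auto
  then show ?case using Forall by (simp add: finite_vimageI)
qed (auto simp: finite_fv_trm)

section \<open>Structural properties of natural deduction\<close>

section \<open>Derivations\<close>

lemma weaken: "proves L H p \<Longrightarrow> H \<subseteq> H' \<Longrightarrow> proves L H' p"
proof (induction arbitrary: H' rule: proves.induct)
  case (ImpI p H q)
  then show ?case by (meson insert_mono proves.ImpI)
next
  case (Raa p H)
  then show ?case by (meson insert_mono proves.Raa)
next
  case (ForallI H p)
  then show ?case by (meson image_mono proves.ForallI)
next
  case (EqSubst H s t p)
  then show ?case by (metis proves.EqSubst)
next
  case (ImpE H p q)
  then show ?case by (metis proves.ImpE)
next
  case (ForallE t H p)
  then show ?case by (metis proves.ForallE)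
qed (auto intro: proves.Assm proves.EqRefl)

text \<open>Only \<open>ForallI\<close> moves the hypotheses; there the induction hypothesis is
  taken at \<open>push \<sigma>\<close>, and \<open>subst_push_lift\<close> restores the form the
  rule expects.\<close>

lemma proves_subst:
  assumes "proves L H p" and "\<And>i. wf_trm L (\<sigma> i)"
  shows "proves L (subst \<sigma> ` H) (subst \<sigma> p)"
  using assms
proof (induction arbitrary: \<sigma> rule: proves.induct)
  case (ImpI p H q)
  from ImpI.IH[OF ImpI.prems] show ?case
    using ImpI.hyps ImpI.prems by (simp add: proves.ImpI wf_subst)
next
  case (ImpE H p q)
  then show ?case by (metis proves.ImpE subst.simps(4))
next
  case (Raa p H)
  have "wf_fm L (subst \<sigma> p)" using Raa.hyps Raa.prems by (simp add: wf_subst)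
  moreover have "proves L (insert (Neg (subst \<sigma> p)) (subst \<sigma> ` H)) Falsum"
    using Raa.IH[of \<sigma>] Raa.prems by (simp add: Neg_def)
  ultimately show ?case by (rule proves.Raa)
next
  case (ForallI H p)
  have "proves L (subst (push \<sigma>) ` lift ` H) (subst (push \<sigma>) p)"
    by (intro ForallI.IH wf_push ForallI.prems)
  then have "proves L (lift ` subst \<sigma> ` H) (subst (push \<sigma>) p)"
    by (simp add: image_image subst_push_lift)
  then show ?case by (simp add: proves.ForallI)
next
  case (ForallE t H p)
  then show ?case by (simp add: subst_inst proves.ForallE wf_subst_trm)
next
  case (EqSubst H s t p)
  then show ?case unfolding subst_inst by (metis proves.EqSubst subst.simps(2))
qed (auto intro: proves.Assm proves.EqRefl wf_subst_trm)

text \<open>Compactness of derivability, needed to see that the union of a chain of consistent sets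
  is consistent.\<close>

lemma proves_finite: "proves L H p \<Longrightarrow> \<exists>G. finite G \<and> G \<subseteq> H \<and> proves L G p"
proof (induction rule: proves.induct)
  case (Assm p H)
  then have "finite {p}" "{p} \<subseteq> H" "proves L {p} p" by (auto intro: proves.Assm)
  then show ?case by blast
next
  case (ImpI p H q)
  then obtain G where G: "finite G" "G \<subseteq> insert p H" "proves L G q" by blast
  then have "finite (G - {p})" "G - {p} \<subseteq> H" "proves L (insert p (G - {p})) q"
    by (auto elim: weaken)
  with ImpI.hyps show ?case by (meson proves.ImpI)
next
  case (ImpE H p q)
  then obtain G G' where "finite G" "G \<subseteq> H" "proves L G (Imp p q)"
    "finite G'" "G' \<subseteq> H" "proves L G' p" by blast
  then have "finite (G \<union> G')" "G \<union> G' \<subseteq> H"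
    "proves L (G \<union> G') (Imp p q)" "proves L (G \<union> G') p"
    by (auto intro: weaken)
  then have "finite (G \<union> G')" "G \<union> G' \<subseteq> H" "proves L (G \<union> G') q"
    by (auto intro: proves.ImpE[of L _ p])
  then show ?case by blast
next
  case (Raa p H)
  then obtain G where G: "finite G" "G \<subseteq> insert (Neg p) H" "proves L G Falsum" by blast
  then have "finite (G - {Neg p})" "G - {Neg p} \<subseteq> H" "proves L (insert (Neg p) (G - {Neg p})) Falsum"
    by (auto elim: weaken)
  with Raa.hyps show ?case by (meson proves.Raa)
next
  case (ForallI H p)
  then obtain G where G: "finite G" "G \<subseteq> lift ` H" "proves L G p" by blast
  then obtain G' where "G' \<subseteq> H" "finite G'" "G = lift ` G'" by (meson finite_subset_image)
  with G show ?case by (meson proves.ForallI)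
next
  case (EqRefl t H)
  then have "finite {}" "{} \<subseteq> H" "proves L {} (Eq t t)" by (auto intro: proves.EqRefl)
  then show ?case by blast
next
  case (EqSubst H s t p)
  then obtain G G' where "finite G" "G \<subseteq> H" "proves L G (Eq s t)"
    "finite G'" "G' \<subseteq> H" "proves L G' (inst s p)" by blast
  then have "finite (G \<union> G')" "G \<union> G' \<subseteq> H"
    "proves L (G \<union> G') (Eq s t)" "proves L (G \<union> G') (inst s p)"
    by (auto intro: weaken)
  then have "finite (G \<union> G')" "G \<union> G' \<subseteq> H" "proves L (G \<union> G') (inst t p)"
    by (auto intro: proves.EqSubst[of L _ s t p])
  then show ?case by blast
next
  case (ForallE t H p)
  then show ?case using proves.ForallE[OF ForallE.hyps(1)] by blast
qed

lemma proves_cut: "proves L H p \<Longrightarrow> proves L (insert p H) q \<Longrightarrow> wf_fm L p \<Longrightarrow> proves L H q"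
  by (rule ImpE[OF ImpI])

lemma ex_falso: "proves L H Falsum \<Longrightarrow> wf_fm L p \<Longrightarrow> proves L H p"
  by (rule Raa, assumption, erule weaken) blast

text \<open>\<open>ForallI\<close> has no named eigenvariable; a variable \<open>x\<close> that is
  not free in the hypotheses becomes one by being renamed to the bound index 0.\<close>

lemma proves_generalize:
  assumes "proves L H (inst (Var x) q)" and "x \<notin> \<Union> (fv ` H)" and "Suc x \<notin> fv q"
  shows "proves L H (Forall q)"
proof -
  \<comment> \<open>On \<open>H\<close>, where \<open>x\<close> is not free, this agrees with
    \<open>lift\<close>; on the instance of \<open>q\<close> it undoes the instantiation.\<close>
  define \<sigma> :: "nat \<Rightarrow> 'a trm" where "\<sigma> i = (if i = x then Var 0 else Var (Suc i))" for i
  have "proves L (subst \<sigma> ` H) (subst \<sigma> (inst (Var x) q))"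
    by (rule proves_subst[OF assms(1)]) (simp add: \<sigma>_def)
  moreover have "subst \<sigma> p = lift p" if "p \<in> H" for p
    unfolding lift_def by (rule subst_cong_fv) (use assms(2) that in \<open>auto simp: \<sigma>_def\<close>)
  then have "subst \<sigma> ` H = lift ` H" by (rule image_cong[OF refl])
  moreover have "subst \<sigma> (inst (Var x) q) = subst Var q"
    unfolding inst_eq subst_subst
    by (rule subst_cong_fv) (use assms(3) in \<open>auto simp: \<sigma>_def split: nat.split\<close>)
  ultimately show ?thesis by (auto intro: ForallI)
qed

section \<open>Tarskian truth in a structure whose carrier is a set\<close>

section \<open>Semantics\<close>

primrec eval :: "('f \<Rightarrow> 'a list \<Rightarrow> 'a) \<Rightarrow> (nat \<Rightarrow> 'a) \<Rightarrow> 'f trm \<Rightarrow> 'a" where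
  "eval F e (Var i) = e i"
| "eval F e (Fun f ts) = F f (map (eval F e) ts)"

primrec sat ::
  "'a set \<Rightarrow> ('f \<Rightarrow> 'a list \<Rightarrow> 'a) \<Rightarrow> ('r \<Rightarrow> 'a list \<Rightarrow> bool) \<Rightarrow> (nat \<Rightarrow> 'a) \<Rightarrow> ('f, 'r) fm \<Rightarrow> bool" where
  "sat D F R e Falsum \<longleftrightarrow> False"
| "sat D F R e (Eq s t) \<longleftrightarrow> eval F e s = eval F e t"
| "sat D F R e (Rel r ts) \<longleftrightarrow> R r (map (eval F e) ts)"
| "sat D F R e (Imp p q) \<longleftrightarrow> (sat D F R e p \<longrightarrow> sat D F R e q)"
| "sat D F R e (Forall p) \<longleftrightarrow> (\<forall>d\<in>D. sat D F R (case_nat d e) p)"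

definition structure_on :: "('f, 'r) signature \<Rightarrow> 'a set \<Rightarrow> ('f \<Rightarrow> 'a list \<Rightarrow> 'a) \<Rightarrow> bool" where
  "structure_on L D F \<longleftrightarrow>
     (\<forall>f as. fun_arity L f = Some (length as) \<longrightarrow> set as \<subseteq> D \<longrightarrow> F f as \<in> D)"

lemma eval_subst: "eval F e (subst_trm \<sigma> t) = eval F (\<lambda>i. eval F e (\<sigma> i)) t"
proof (induction t)
  case (Fun f ts)
  then have "map (eval F e \<circ> subst_trm \<sigma>) ts = map (eval F (\<lambda>i. eval F e (\<sigma> i))) ts" by simp
  then show ?case by (simp only: subst_trm.simps eval.simps map_map)
qed simp

lemma eval_push: "(\<lambda>i. eval F (case_nat d e) (push \<sigma> i)) = case_nat d (\<lambda>i. eval F e (\<sigma> i))"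
  by (rule ext) (auto simp: push_def eval_subst split: nat.split)

lemma sat_subst: "sat D F R e (subst \<sigma> p) \<longleftrightarrow> sat D F R (\<lambda>i. eval F e (\<sigma> i)) p"
  by (induction p arbitrary: \<sigma> e) (auto simp: eval_subst eval_push comp_def)

lemma sat_connectives [simp]:
  "sat D F R e (Neg p) \<longleftrightarrow> \<not> sat D F R e p"
  "sat D F R e (And p q) \<longleftrightarrow> sat D F R e p \<and> sat D F R e q"
  "sat D F R e (Or p q) \<longleftrightarrow> sat D F R e p \<or> sat D F R e q"
  "sat D F R e (Iff p q) \<longleftrightarrow> (sat D F R e p \<longleftrightarrow> sat D F R e q)"
  "sat D F R e (Exists p) \<longleftrightarrow> (\<exists>d\<in>D. sat D F R (case_nat d e) p)"
  by (auto simp: Neg_def And_def Or_def Iff_def Exists_def)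

section \<open>Henkin's completeness proof for countable languages\<close>

section \<open>Completeness\<close>

definition consistent :: "('f, 'r) signature \<Rightarrow> ('f, 'r) fm set \<Rightarrow> bool" where
  "consistent L H \<longleftrightarrow> \<not> proves L H Falsum"

lemma consistent_subset: "consistent L H \<Longrightarrow> G \<subseteq> H \<Longrightarrow> consistent L G"
  unfolding consistent_def by (meson weaken)

text \<open>Witnesses are free variables rather than new constants, so the language stays fixed
  throughout the construction.\<close>

definition henkin :: "('f, 'r) signature \<Rightarrow> ('f, 'r) fm set \<Rightarrow> bool" where
  "henkin L H \<longleftrightarrow> consistent L H \<and> (\<forall>p\<in>H. wf_fm L p) \<and>
     (\<forall>p. wf_fm L p \<longrightarrow> consistent L (insert p H) \<longrightarrow> p \<in> H) \<and>
     (\<forall>q. Neg (Forall q) \<in> H \<longrightarrow> (\<exists>x. Neg (inst (Var x) q) \<in> H))"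

text \<open>Otherwise the instance at the fresh variable \<open>x\<close> would be provable from
  \<open>H\<close>, hence \<open>Forall q\<close> as well, against its negation in
  \<open>H\<close>.\<close>

lemma consistent_witness:
  assumes "consistent L H" and neg: "Neg (Forall q) \<in> H" and wf: "wf_fm L q"
    and "x \<notin> \<Union> (fv ` H)"
  shows "consistent L (insert (Neg (inst (Var x) q)) H)"
  unfolding consistent_def
proof
  assume "proves L (insert (Neg (inst (Var x) q)) H) Falsum"
  moreover have "wf_fm L (inst (Var x) q)" by (rule wf_inst[OF _ wf]) simp
  ultimately have "proves L H (inst (Var x) q)" by (rule Raa[rotated])
  moreover have "Suc x \<notin> fv q" using assms(4) neg by (auto simp: Neg_def)
  ultimately have "proves L H (Forall q)" using assms(4) by (intro proves_generalize)
  then have "proves L H Falsum" using neg by (metis Assm ImpE Neg_def)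
  with assms(1) show False by (simp add: consistent_def)
qed

instance trm :: (countable) countable by countable_datatype
instance fm :: (countable, countable) countable by countable_datatype

text \<open>The formulas are enumerated. Stage n adds the n-th one if it is well-formed and
  consistent with what is there, along with a witness if it is a negated universal. Each stage has
  only finitely many free variables, so a fresh one is always available.\<close>

lemma henkin_extension:
  fixes H :: "('f::countable, 'r::countable) fm set"
  assumes "consistent L H" and "\<forall>p\<in>H. wf_fm L p" and "finite (\<Union> (fv ` H))"
  shows "\<exists>G. H \<subseteq> G \<and> henkin L G"
proof -
  define inv where "inv G \<longleftrightarrow> consistent L G \<and> (\<forall>p\<in>G. wf_fm L p) \<and> finite (\<Union> (fv ` G))" for G
  define adds where "adds p G G' \<longleftrightarrow> G \<subseteq> G' \<and> (wf_fm L p \<longrightarrow> consistent L (insert p G) \<longrightarrow> p \<in> G' \<and>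
    (\<forall>q. p = Neg (Forall q) \<longrightarrow> (\<exists>x. Neg (inst (Var x) q) \<in> G')))" for p G G'
  have step: "\<exists>G'. inv G' \<and> adds p G G'" if inv: "inv G" for G p
  proof (cases "wf_fm L p \<and> consistent L (insert p G)")
    case False
    with inv show ?thesis unfolding adds_def by blast
  next
    case True
    then have inv': "inv (insert p G)" using inv by (simp add: inv_def finite_fv)
    show ?thesis
    proof (cases "\<exists>q. p = Neg (Forall q)")
      case False
      with inv' show ?thesis unfolding adds_def by blast
    next
      case True
      then obtain q where q: "p = Neg (Forall q)" by blast
      have fin: "finite (\<Union> (fv ` insert p G))" using inv' by (simp add: inv_def)
      obtain x where x: "x \<notin> \<Union> (fv ` insert p G)"
        using ex_new_if_finite[OF infinite_UNIV_nat fin] by blast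
      have wf: "wf_fm L q" using inv' q by (simp add: inv_def)
      let ?G = "insert (Neg (inst (Var x) q)) (insert p G)"
      have "consistent L ?G"
        by (rule consistent_witness[OF _ _ wf x]) (use inv' q in \<open>simp_all add: inv_def\<close>)
      moreover have "wf_fm L (inst (Var x) q)" by (rule wf_inst[OF _ wf]) simp
      ultimately have "inv ?G" using inv' by (simp add: inv_def finite_fv)
      moreover have "adds p G ?G" using q by (auto simp: adds_def Neg_def)
      ultimately show ?thesis by blast
    qed
  qed
  \<comment> \<open>The clause for \<open>n = 0\<close> pins the start of the chain to
    \<open>H\<close>.\<close>
  have "\<exists>f. \<forall>n. (inv (f n) \<and> (n = 0 \<longrightarrow> f n = H)) \<and> adds (from_nat n) (f n) (f (Suc n))"
  proof (rule dependent_nat_choice[where P = "\<lambda>n G. inv G \<and> (n = 0 \<longrightarrow> G = H)"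
        and Q = "\<lambda>n G G'. adds (from_nat n) G G'"])
    show "\<exists>G. inv G \<and> (0 = (0::nat) \<longrightarrow> G = H)" using assms inv_def by blast
    show "\<exists>G'. (inv G' \<and> (Suc n = 0 \<longrightarrow> G' = H)) \<and> adds (from_nat n) G G'"
      if "inv G \<and> (n = 0 \<longrightarrow> G = H)" for G n
      using step[of G "from_nat n"] that by blast
  qed
  then obtain f where inv: "\<And>n. inv (f n)" and f0: "f 0 = H"
    and adds: "\<And>n. adds (from_nat n) (f n) (f (Suc n))"
    by blast
  have mono: "f m \<subseteq> f n" if "m \<le> n" for m n
    by (rule lift_Suc_mono_le[OF _ that]) (use adds adds_def in blast)
  let ?G = "\<Union> (range f)"
  have cons: "consistent L ?G"
    unfolding consistent_def
  proof
    assume "proves L ?G Falsum"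
    then obtain K where K: "finite K" "K \<subseteq> ?G" "proves L K Falsum"
      by (blast dest: proves_finite)
    \<comment> \<open>The stages increase, so a finite set of formulas from the union already lies
      in one of them.\<close>
    have "\<exists>n. K \<subseteq> f n"
      using K(1,2)
    proof (induction rule: finite_induct)
      case (insert p K)
      then obtain m n where "K \<subseteq> f n" "p \<in> f m" by blast
      then have "insert p K \<subseteq> f (max m n)" using mono[of n "max m n"] mono[of m "max m n"] by auto
      then show ?case by blast
    qed simp
    then obtain n where "proves L (f n) Falsum" using K(3) weaken by blast
    with inv[of n] show False by (simp add: inv_def consistent_def)
  qed
  \<comment> \<open>Each formula is treated at the stage given by its own number.\<close>
  have added: "adds p (f (to_nat p)) (f (Suc (to_nat p)))" for p
    using adds[of "to_nat p"] by simp
  have "henkin L ?G"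
    unfolding henkin_def
  proof (intro conjI allI impI cons)
    show "\<forall>p\<in>?G. wf_fm L p" using inv unfolding inv_def by blast
    fix p assume "wf_fm L p" "consistent L (insert p ?G)"
    moreover from this(2) have "consistent L (insert p (f (to_nat p)))"
      by (rule consistent_subset) auto
    ultimately show "p \<in> ?G" using added[of p] unfolding adds_def by blast
  next
    fix q assume q: "Neg (Forall q) \<in> ?G"
    let ?p = "Neg (Forall q)"
    have "wf_fm L ?p" using q inv unfolding inv_def by blast
    moreover have "consistent L (insert ?p (f (to_nat ?p)))"
      by (rule consistent_subset[OF cons]) (use q in auto)
    ultimately show "\<exists>x. Neg (inst (Var x) q) \<in> ?G" using added[of ?p] unfolding adds_def by blast
  qed
  moreover have "H \<subseteq> ?G" using f0 by blast
  ultimately show ?thesis by blast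
qed

locale henkin_set =
  fixes L :: "('f, 'r) signature" and H :: "('f, 'r) fm set"
  assumes henkin: "henkin L H"
begin

lemma closed: "proves L H p \<Longrightarrow> wf_fm L p \<Longrightarrow> p \<in> H"
  using henkin unfolding henkin_def consistent_def by (meson proves_cut)

lemma Falsum_notin: "Falsum \<notin> H"
  using henkin Assm unfolding henkin_def consistent_def by blast

lemma Neg_mem: "wf_fm L p \<Longrightarrow> Neg p \<in> H \<longleftrightarrow> p \<notin> H"
proof
  assume "Neg p \<in> H" "wf_fm L p"
  then show "p \<notin> H"
    by (metis Assm Falsum_notin ImpE Neg_def closed wf_fm.simps(1))
next
  assume p: "wf_fm L p" "p \<notin> H"
  then have "proves L (insert p H) Falsum"
    using henkin unfolding henkin_def consistent_def by blast
  with p(1) show "Neg p \<in> H" by (intro closed) (simp_all add: Neg_def ImpI)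
qed

lemma Imp_mem:
  assumes "wf_fm L p" "wf_fm L q"
  shows "Imp p q \<in> H \<longleftrightarrow> (p \<in> H \<longrightarrow> q \<in> H)"
proof
  assume "Imp p q \<in> H"
  then show "p \<in> H \<longrightarrow> q \<in> H" using assms by (metis Assm ImpE closed)
next
  assume r: "p \<in> H \<longrightarrow> q \<in> H"
  have "proves L (insert p H) q"
  proof (cases "p \<in> H")
    case True
    with r show ?thesis by (auto intro: Assm)
  next
    case False
    then have "proves L (insert p H) Falsum"
      using assms henkin unfolding henkin_def consistent_def by blast
    then show ?thesis using assms by (blast intro: ex_falso)
  qed
  then show "Imp p q \<in> H" using assms by (intro closed) (simp_all add: ImpI)
qed

lemma Forall_mem:
  assumes "wf_fm L q"
  shows "Forall q \<in> H \<longleftrightarrow> (\<forall>t. wf_trm L t \<longrightarrow> inst t q \<in> H)"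
proof
  assume "Forall q \<in> H"
  then show "\<forall>t. wf_trm L t \<longrightarrow> inst t q \<in> H"
    using assms by (simp add: closed wf_inst Assm ForallE)
next
  assume r: "\<forall>t. wf_trm L t \<longrightarrow> inst t q \<in> H"
  show "Forall q \<in> H"
  proof (rule ccontr)
    assume "Forall q \<notin> H"
    then have "Neg (Forall q) \<in> H" using assms by (simp add: Neg_mem)
    then obtain x where "Neg (inst (Var x) q) \<in> H" using henkin unfolding henkin_def by blast
    moreover have "wf_fm L (inst (Var x) q)" using assms by (intro wf_inst) auto
    ultimately show False using r Neg_mem by auto
  qed
qed

lemma Eq_refl: "wf_trm L t \<Longrightarrow> Eq t t \<in> H"
  by (simp add: closed EqRefl)

lemma Eq_replace: "Eq s t \<in> H \<Longrightarrow> inst s p \<in> H \<Longrightarrow> wf_fm L (inst t p) \<Longrightarrow> inst t p \<in> H"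
  by (rule closed, rule EqSubst[of L H s t p]) (simp_all add: Assm)

lemma Eq_wf: "Eq s t \<in> H \<Longrightarrow> wf_trm L s \<and> wf_trm L t"
  using henkin unfolding henkin_def by fastforce

lemma Eq_sym: "Eq s t \<in> H \<Longrightarrow> Eq t s \<in> H"
  using Eq_replace[of s t "Eq (Var 0) (subst_trm (\<lambda>i. Var (Suc i)) s)"] Eq_refl[of s] Eq_wf[of s t]
  by (simp add: inst_eq)

lemma Eq_trans: "Eq r s \<in> H \<Longrightarrow> Eq s t \<in> H \<Longrightarrow> Eq r t \<in> H"
  using Eq_replace[of s t "Eq (subst_trm (\<lambda>i. Var (Suc i)) r) (Var 0)"] Eq_wf[of r s] Eq_wf[of s t]
  by (simp add: inst_eq)

lemma inst_shift_trms [simp]: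
  "map (subst_trm (case_nat t Var) \<circ> subst_trm (\<lambda>i. Var (Suc i))) as = as"
  by (simp add: comp_def)

text \<open>Arguments are exchanged one at a time from the left; \<open>as\<close> holds those
  already dealt with.\<close>

lemma Fun_cong:
  assumes "list_all2 (\<lambda>s t. Eq s t \<in> H) ss ts" and "wf_trm L (Fun f (as @ ss))"
  shows "Eq (Fun f (as @ ss)) (Fun f (as @ ts)) \<in> H"
  using assms
proof (induction arbitrary: as rule: list_all2_induct)
  case Nil
  then show ?case by (simp add: Eq_refl del: wf_trm.simps)
next
  case (Cons s ss t ts)
  let ?up = "subst_trm (\<lambda>i. Var (Suc i))"
  \<comment> \<open>\<open>Var 0\<close> marks the argument to be exchanged; all other terms are
    shifted so that instantiation leaves them alone.\<close>
  let ?p = "Eq (?up (Fun f (as @ s # ss))) (Fun f (map ?up as @ Var 0 # map ?up ss))"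
  have wf: "wf_trm L (Fun f (as @ t # ss))" using Cons.prems Eq_wf[OF Cons.hyps(1)] by auto
  have "Eq (Fun f (as @ s # ss)) (Fun f (as @ s # ss)) \<in> H"
    using Cons.prems by (rule Eq_refl)
  then have "Eq (Fun f (as @ s # ss)) (Fun f (as @ t # ss)) \<in> H"
    using Eq_replace[OF Cons.hyps(1), of ?p] Cons.prems wf by (simp add: inst_eq comp_def)
  moreover have "Eq (Fun f ((as @ [t]) @ ss)) (Fun f ((as @ [t]) @ ts)) \<in> H"
    using wf by (intro Cons.IH) auto
  ultimately show ?case by (auto intro: Eq_trans)
qed

lemma Rel_cong:
  assumes "list_all2 (\<lambda>s t. Eq s t \<in> H) ss ts" and "Rel r (as @ ss) \<in> H"
  shows "Rel r (as @ ts) \<in> H"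
  using assms
proof (induction arbitrary: as rule: list_all2_induct)
  case (Cons s ss t ts)
  let ?up = "subst_trm (\<lambda>i. Var (Suc i))"
  let ?p = "Rel r (map ?up as @ Var 0 # map ?up ss)"
  have "wf_fm L (Rel r (as @ s # ss))" using Cons.prems henkin unfolding henkin_def by blast
  then have "Rel r (as @ t # ss) \<in> H"
    using Eq_replace[OF Cons.hyps(1), of ?p] Cons.prems Eq_wf[OF Cons.hyps(1)]
    by (simp add: inst_eq comp_def)
  then show ?case using Cons.IH[of "as @ [t]"] by simp
qed simp

definition cls :: "'f trm \<Rightarrow> 'f trm set" where
  "cls t = {s. Eq t s \<in> H}"

lemma cls_eq: "wf_trm L s \<Longrightarrow> cls s = cls t \<longleftrightarrow> Eq s t \<in> H"
  unfolding cls_def by (blast intro: Eq_sym Eq_trans Eq_refl)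

definition rep :: "'f trm set \<Rightarrow> 'f trm" where
  "rep a = (SOME t. t \<in> a)"

lemma rep_cls: "wf_trm L t \<Longrightarrow> Eq t (rep (cls t)) \<in> H"
  unfolding rep_def cls_def mem_Collect_eq by (rule someI_ex) (blast intro: Eq_refl)

definition term_domain :: "'f trm set set" where
  "term_domain = cls ` {t. wf_trm L t}"

text \<open>Operations act on chosen representatives; \<open>Fun_cong\<close> makes the resulting
  class independent of the choice.\<close>

definition term_fun :: "'f \<Rightarrow> 'f trm set list \<Rightarrow> 'f trm set" where
  "term_fun f as = cls (Fun f (map rep as))"

definition term_rel :: "'r \<Rightarrow> 'f trm set list \<Rightarrow> bool" where
  "term_rel r as \<longleftrightarrow> Rel r (map rep as) \<in> H"

lemma reps: "list_all (wf_trm L) ts \<Longrightarrow> list_all2 (\<lambda>s t. Eq s t \<in> H) ts (map (rep \<circ> cls) ts)"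
  by (induction ts) (auto intro: rep_cls)

lemma term_structure: "structure_on L term_domain term_fun"
proof -
  have "wf_trm L (rep a)" if "a \<in> term_domain" for a
    using that rep_cls Eq_wf unfolding term_domain_def by blast
  then have "wf_trm L (Fun f (map rep as))"
    if "fun_arity L f = Some (length as)" "set as \<subseteq> term_domain" for f as
    using that by (auto simp: list_all_iff)
  then show ?thesis unfolding structure_on_def term_fun_def term_domain_def by blast
qed

lemma term_eval:
  assumes "\<And>i. wf_trm L (\<sigma> i)"
  shows "wf_trm L t \<Longrightarrow> eval term_fun (\<lambda>i. cls (\<sigma> i)) t = cls (subst_trm \<sigma> t)"
proof (induction t)
  case (Fun f ts)
  let ?ts = "map (subst_trm \<sigma>) ts"
  have "map (eval term_fun (\<lambda>i. cls (\<sigma> i))) ts = map cls ?ts"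
    using Fun by (auto simp: list_all_iff)
  moreover have wf: "wf_trm L (Fun f ?ts)"
    using wf_subst_trm[OF Fun.prems, of \<sigma>] assms by simp
  then have "Eq (Fun f ?ts) (Fun f (map (rep \<circ> cls) ?ts)) \<in> H"
    using Fun_cong[OF reps[of ?ts], of f "[]"] by (simp add: list_all_iff)
  then have "cls (Fun f ?ts) = cls (Fun f (map (rep \<circ> cls) ?ts))"
    using cls_eq[OF wf] by blast
  ultimately show ?case by (simp only: eval.simps subst_trm.simps term_fun_def[of f "map (cls \<circ> subst_trm \<sigma>) ts"] map_map
      comp_assoc)
qed simp

text \<open>The substitution must be arbitrary: a quantifier over classes amounts to one over terms
  placed in front of \<sigma>.\<close>

lemma truth:
  assumes "\<And>i. wf_trm L (\<sigma> i)" and "wf_fm L p"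
  shows "sat term_domain term_fun term_rel (\<lambda>i. cls (\<sigma> i)) p \<longleftrightarrow> subst \<sigma> p \<in> H"
  using assms
proof (induction p arbitrary: \<sigma>)
  case Falsum
  then show ?case by (simp add: Falsum_notin)
next
  case (Eq s t)
  then show ?case by (simp add: term_eval cls_eq wf_subst_trm)
next
  case (Rel r ts)
  let ?ts = "map (subst_trm \<sigma>) ts"
  have "map (eval term_fun (\<lambda>i. cls (\<sigma> i))) ts = map cls ?ts"
    using Rel by (auto simp: list_all_iff term_eval)
  moreover have r: "list_all2 (\<lambda>s t. Eq s t \<in> H) ?ts (map (rep \<circ> cls) ?ts)"
    using Rel by (intro reps) (auto simp: list_all_iff wf_subst_trm)
  moreover have "list_all2 (\<lambda>s t. Eq s t \<in> H) (map (rep \<circ> cls) ?ts) ?ts"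
    using r unfolding list_all2_conv_all_nth by (metis Eq_sym)
  ultimately show ?case
    using Rel_cong[OF r, of r "[]"] Rel_cong[of "map (rep \<circ> cls) ?ts" ?ts r "[]"]
    by (simp only: sat.simps subst.simps term_rel_def[of r "map (cls \<circ> subst_trm \<sigma>) ts"] map_map
      comp_assoc append_Nil) blast
next
  case (Imp p q)
  then show ?case by (simp add: Imp_mem wf_subst)
next
  case (Forall p)
  have "sat term_domain term_fun term_rel (case_nat (cls t) (\<lambda>i. cls (\<sigma> i))) p \<longleftrightarrow>
      inst t (subst (push \<sigma>) p) \<in> H" if "wf_trm L t" for t
  proof -
    have eq: "case_nat (cls t) (\<lambda>i. cls (\<sigma> i)) = (\<lambda>i. cls (case_nat t \<sigma> i))"
      by (rule ext) (simp split: nat.split)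
    show ?thesis
      unfolding inst_push eq
      by (rule Forall.IH) (use Forall.prems that in \<open>auto split: nat.split\<close>)
  qed
  moreover have "wf_fm L (subst (push \<sigma>) p)"
    using Forall.prems by (intro wf_subst wf_push) auto
  ultimately show ?case by (simp add: Forall_mem term_domain_def)
qed

end

text \<open>Otherwise the term model of a Henkin set containing \<open>A\<close> and
  \<open>Neg p\<close> is a countermodel. Validity is asked only for carriers made of sets of terms,
  the type in which that model lives. Closedness of \<open>A\<close> leaves finitely many free
  variables.\<close>

theorem completeness:
  fixes A :: "('f::countable, 'r::countable) fm set"
  assumes wf: "\<And>a. a \<in> A \<Longrightarrow> wf_fm L a" and closed: "\<And>a. a \<in> A \<Longrightarrow> fv a = {}"
    and wf_p: "wf_fm L p"
    and valid: "\<And>D F R e. structure_on L (D :: 'f trm set set) F \<Longrightarrow> (\<And>i. e i \<in> D) \<Longrightarrow>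
      (\<And>a. a \<in> A \<Longrightarrow> sat D F R e a) \<Longrightarrow> sat D F R e p"
  shows "proves L A p"
proof (rule ccontr)
  assume np: "\<not> proves L A p"
  let ?H = "insert (Neg p) A"
  have "consistent L ?H"
    using np wf_p Raa unfolding consistent_def by blast
  moreover have "finite (\<Union> (fv ` ?H))" using closed by (simp add: finite_fv)
  ultimately obtain G where G: "?H \<subseteq> G" "henkin L G"
    using henkin_extension[of L ?H] wf wf_p by auto
  interpret henkin_set L G by unfold_locales (rule G)
  have sat: "sat term_domain term_fun term_rel (\<lambda>i. cls (Var i)) q \<longleftrightarrow> q \<in> G" if "wf_fm L q" for q
    using truth[of Var q] that by simp
  have "sat term_domain term_fun term_rel (\<lambda>i. cls (Var i)) p"
    by (rule valid[OF term_structure]) (use G sat wf in \<open>auto simp: term_domain_def\<close>)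
  then show False using sat[of p] wf_p G Neg_mem[of p] by auto
qed

text \<open>Both sides are cut at their first \<open>x\<close>.\<close>

lemma append_Cons_eq_iff2:
  "x \<notin> set xs \<Longrightarrow> x \<notin> set xs' \<Longrightarrow> xs @ x # ys = xs' @ x # ys' \<longleftrightarrow> xs = xs' \<and> ys = ys'"
proof (induction xs arbitrary: xs')
  case Nil
  then show ?case by (cases xs') auto
next
  case (Cons a xs)
  then show ?case by (cases xs') auto
qed

section \<open>A unary prefix code and its alignment properties\<close>

section \<open>Coding sequences of numbers by words\<close>

text \<open>The letter \<open>L1\<close> closes each block, which gives unique readability. The
  symbols 0 and 1 will carry bits; 2 and 3 are kept for markers.\<close>

definition enc :: "nat list \<Rightarrow> letter list" where
  "enc ns = concat (map (\<lambda>n. replicate n L2 @ [L1]) ns)"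

lemma enc_Nil [simp]: "enc [] = []"
  by (simp add: enc_def)

lemma enc_Cons: "enc (n # ns) = replicate n L2 @ L1 # enc ns"
  by (simp add: enc_def)

lemma enc_append: "enc (ms @ ns) = enc ms @ enc ns"
  by (simp add: enc_def)

lemma enc_singletons [simp]:
  "enc [0] = [L1]" "enc [1] = [L2, L1]" "enc [Suc 0] = [L2, L1]" "enc [2] = [L2, L2, L1]"
  "enc [3] = [L2, L2, L2, L1]"
  by (simp_all add: enc_def numeral_eq_Suc)

lemma enc_surj: "\<exists>ns. enc ns = xs @ [L1]"
proof -
  \<comment> \<open>Here \<open>k\<close> counts the letters \<open>L2\<close> read since the last
    \<open>L1\<close>.\<close>
  have "\<exists>ns. enc ns = replicate k L2 @ xs @ [L1]" for k
  proof (induction xs arbitrary: k)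
    case Nil
    have "enc [k] = replicate k L2 @ [] @ [L1]" by (simp add: enc_Cons)
    then show ?case by blast
  next
    case (Cons d xs)
    show ?case
    proof (cases d)
      case L1
      obtain ns where "enc ns = replicate 0 L2 @ xs @ [L1]" using Cons.IH by blast
      then have "enc (k # ns) = replicate k L2 @ (d # xs) @ [L1]" by (simp add: enc_Cons L1)
      then show ?thesis by blast
    next
      case L2
      obtain ns where "enc ns = replicate (Suc k) L2 @ xs @ [L1]" using Cons.IH by blast
      then show ?thesis using L2 by (metis append_Cons replicate_Suc replicate_app_Cons_same)
    qed
  qed
  from this[of 0] show ?thesis by simp
qed

text \<open>Unique readability: the first \<open>L1\<close> on either side closes the first
  block.\<close>

lemma enc_prefixD: "enc ms @ ys = enc ns \<Longrightarrow> \<exists>ks. ns = ms @ ks \<and> ys = enc ks"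
proof (induction ms arbitrary: ns)
  case (Cons m ms)
  then obtain n ns' where ns: "ns = n # ns'" by (cases ns) (auto simp: enc_Cons)
  then have "replicate m L2 @ L1 # (enc ms @ ys) = replicate n L2 @ L1 # enc ns'"
    using Cons.prems by (simp add: enc_Cons)
  then have "replicate m L2 = replicate n (L2 :: letter)" "enc ms @ ys = enc ns'"
    by (simp_all add: append_Cons_eq_iff2)
  then have "m = n" "\<exists>ks. ns' = ms @ ks \<and> ys = enc ks"
    using Cons.IH by (auto dest: arg_cong[where f = length])
  then show ?case using ns by auto
qed simp

lemma prefix_enc: "prefix (enc ms) (enc ns) \<longleftrightarrow> prefix ms ns"
  by (auto simp: prefix_def enc_append dest: enc_prefixD dest!: sym[of "enc ns"])

lemma enc_inj: "enc ms = enc ns \<longleftrightarrow> ms = ns"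
proof
  assume "enc ms = enc ns"
  then obtain ks where "ns = ms @ ks" "[] = enc ks" using enc_prefixD[of ms "[]" ns] by auto
  then show "ms = ns" by (cases ks) (simp_all add: enc_Cons)
qed simp

text \<open>A cut right after any \<open>L1\<close> falls between two blocks. This is why markers
  are searched for together with a preceding \<open>L1\<close>.\<close>

lemma enc_split: "xs @ L1 # ys = enc ns \<Longrightarrow> \<exists>ks ms. ns = ks @ ms \<and> enc ks = xs @ [L1] \<and> enc ms = ys"
proof -
  assume eq: "xs @ L1 # ys = enc ns"
  obtain ks where ks: "enc ks = xs @ [L1]" using enc_surj by blast
  then have "enc ks @ ys = enc ns" using eq by simp
  then show ?thesis using enc_prefixD ks by blast
qed

lemma enc_suffix_L1: "ns \<noteq> [] \<Longrightarrow> suffix [L1] (enc ns)"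
  by (cases ns rule: rev_cases) (auto simp: enc_append enc_Cons suffix_def)

text \<open>Together with \<open>enc_suffix_L1\<close>, this makes being a nonempty code expressible
  by the suffix relation.\<close>

lemma suffix_L1_enc: "suffix [L1] xs \<Longrightarrow> \<exists>ns. xs = enc ns"
proof -
  assume "suffix [L1] xs"
  then obtain ys where "xs = ys @ [L1]" by (auto simp: suffix_def)
  then show ?thesis using enc_surj[of ys] by metis
qed

section \<open>Membership of a pair in a coded set, and its correctness\<close>

section \<open>Words coding finite sets of pairs\<close>

text \<open>The word \<open>w\<close> contains a block \<open>$u#q$\<close>, where the markers are the symbols \<open># = 2\<close> and
  \<open>$ = 3\<close>. A leading \<open>L1\<close>, written as the symbol 0, aligns occurrences with the coding.\<close>

definition in_word :: "letter list \<Rightarrow> letter list \<Rightarrow> letter list \<Rightarrow> bool" where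
  "in_word w u q \<longleftrightarrow> (\<exists>p v. prefix p w \<and> suffix v p \<and> suffix (enc [0, 3] @ v) p \<and>
     prefix u v \<and> prefix (u @ enc [2]) v \<and> suffix [L1] u \<and> suffix (enc [0, 2, 0] @ q @ enc [3]) v \<and>
     (\<forall>p'. prefix p' v \<longrightarrow> suffix (enc [0, 3]) p' \<longrightarrow> p' = v))"

text \<open>Each block stands between two markers 3; the initial 0 supplies the \<open>L1\<close>
  required before the first marker.\<close>

definition blocks :: "nat list list \<Rightarrow> nat list" where
  "blocks Ms = 0 # 3 # concat (map (\<lambda>M. M @ [3]) Ms)"

lemma enc_03: "enc [0, 3] = [L1, L2, L2, L2, L1]"
  by (simp add: enc_def numeral_eq_Suc)

lemma enc_020: "enc [0, 2, 0] = [L1, L2, L2, L1, L1]"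
  by (simp add: enc_def numeral_eq_Suc)

lemma blocks_append: "blocks (Ms @ M # Ns) = (blocks Ms @ M @ [3]) @ concat (map (\<lambda>M. M @ [3]) Ns)"
  by (simp add: blocks_def)

lemma blocks_last: "\<exists>ns. ns \<noteq> [] \<and> blocks Ms = ns @ [3]"
proof (cases Ms rule: rev_cases)
  case Nil
  then have "[0] \<noteq> []" "blocks Ms = [0] @ [3]" by (simp_all add: blocks_def)
  then show ?thesis by blast
next
  case (snoc Ns M)
  then have "blocks Ms = (blocks Ns @ M) @ [3]" "blocks Ns @ M \<noteq> []" by (simp_all add: blocks_def)
  then show ?thesis by blast
qed

lemma enc_last_L1: "ns \<noteq> [] \<Longrightarrow> \<exists>xs. enc ns = xs @ [L1]"
  using enc_suffix_L1[of ns] by (auto simp: suffix_def)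

text \<open>Witnesses: \<open>p\<close> is the part of the word up to the end of the block,
  \<open>v\<close> the code of the block with its closing marker.\<close>

lemma in_word_blocksI:
  assumes "U @ [2, 0] @ Q \<in> set Ms" and "3 \<notin> set U" "3 \<notin> set Q" "U \<noteq> []"
  shows "in_word (enc (blocks Ms)) (enc U) (enc Q)"
proof -
  let ?M = "U @ [2, 0] @ Q"
  let ?v = "enc (?M @ [3])"
  obtain Ms1 Ms2 where Ms: "Ms = Ms1 @ ?M # Ms2" using assms(1) by (meson split_list)
  let ?p = "enc (blocks Ms1 @ ?M @ [3])"
  \<comment> \<open>What precedes the block is a 3 after at least one symbol, so its code ends in
    \<open>enc [0, 3]\<close>.\<close>
  obtain ns b where "blocks Ms1 = ns @ [3]" "enc ns = b @ [L1]"
    using blocks_last enc_last_L1 by metis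
  then have b: "enc (blocks Ms1) = b @ enc [0, 3]"
    by (simp add: enc_append enc_03)
  have 1: "prefix ?p (enc (blocks Ms))"
    unfolding Ms blocks_append enc_append[of "blocks Ms1 @ _"] by (rule prefixI) (rule refl)
  have 2: "?p = b @ enc [0, 3] @ ?v"
    by (simp only: enc_append b append_assoc)
  have v: "?v = enc U @ enc [2] @ enc [0] @ enc Q @ enc [3]"
    by (simp add: enc_append enc_Cons numeral_eq_Suc)
  have 3: "suffix (enc [0, 2, 0] @ enc Q @ enc [3]) ?v"
  proof -
    obtain u where "enc U = u @ [L1]" using enc_suffix_L1[OF assms(4)] by (auto simp: suffix_def)
    then show ?thesis unfolding v by (simp add: enc_020 suffix_def)
  qed
  have 4: "p' = ?v" if pre: "prefix p' ?v" and suf: "suffix (enc [0, 3]) p'" for p'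
  proof -
    obtain t where t: "p' = t @ enc [0, 3]" using suf by (auto simp: suffix_def)
    obtain r where r: "?v = t @ L1 # (L2 # L2 # L2 # L1 # r)"
      using pre by (auto simp: t prefix_def enc_03)
    obtain A B where AB: "?M @ [3] = A @ B" "enc A = t @ [L1]" "enc B = L2 # L2 # L2 # L1 # r"
      using enc_split[OF r[symmetric]] by blast
    have "enc [3] @ r = enc B" using AB(3) by simp
    then obtain K where K: "B = [3] @ K" "r = enc K" using enc_prefixD by blast
    \<comment> \<open>A 3 before the end of \<open>?v\<close> would be a symbol of
      \<open>?M\<close>, which has none.\<close>
    have "K = []"
    proof (rule ccontr)
      assume "K \<noteq> []"
      then obtain ys k where "K = ys @ [k]" by (cases K rule: rev_cases) auto
      then have "?M = A @ [3] @ ys" using AB(1) K(1) by simp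
      then have "3 \<in> set ?M" by (simp only: set_append) simp
      then show False using assms(2,3) by simp
    qed
    then show ?thesis using r K(2) by (simp add: t enc_03)
  qed
  show ?thesis
    unfolding in_word_def
  proof (intro exI conjI allI impI)
    show "prefix ?p (enc (blocks Ms))" by (rule 1)
    show "suffix ?v ?p" "suffix (enc [0, 3] @ ?v) ?p" unfolding 2 by (simp_all add: suffix_def)
    show "prefix (enc U) ?v" "prefix (enc U @ enc [2]) ?v" unfolding v by (simp_all add: prefix_def)
    show "suffix [L1] (enc U)" by (rule enc_suffix_L1[OF assms(4)])
  qed (use 3 4 in auto)
qed

text \<open>No block contains 3, so a stretch without 3 between two markers fills the gap between
  consecutive markers. Blocks are peeled off from the left.\<close>

lemma blocks_memD:
  assumes "A @ 3 # R @ 3 # B = 3 # concat (map (\<lambda>M. M @ [3]) Ms)"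
    and "3 \<notin> set R" and "\<And>M. M \<in> set Ms \<Longrightarrow> 3 \<notin> set M"
  shows "R \<in> set Ms"
  using assms(1,3)
proof (induction Ms arbitrary: A)
  case Nil
  then show ?case by (cases A) auto
next
  case (Cons M Ms)
  show ?case
  proof (cases A)
    case Nil
    then have "R @ 3 # B = M @ 3 # concat (map (\<lambda>M. M @ [3]) Ms)" using Cons.prems by simp
    then show ?thesis using append_Cons_eq_iff2[of 3 R M] assms(2) Cons.prems(2) by auto
  next
    case (Cons a A')
    then have eq: "A' @ 3 # R @ 3 # B = M @ 3 # concat (map (\<lambda>M. M @ [3]) Ms)"
      using Cons.prems by simp
    show ?thesis
    proof (cases "3 \<in> set A'")
      case False
      then have "R @ 3 # B = concat (map (\<lambda>M. M @ [3]) Ms)"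
        using append_Cons_eq_iff2[of 3 A' M] eq Cons.prems(2) by auto
      then have "[] @ 3 # R @ 3 # B = 3 # concat (map (\<lambda>M. M @ [3]) Ms)" by simp
      then show ?thesis using Cons.IH[of "[]"] Cons.prems(2) by auto
    next
      case True
      then obtain A1 A2 where A: "A' = A1 @ 3 # A2" "3 \<notin> set A1" by (meson split_list_first)
      then have "A2 @ 3 # R @ 3 # B = concat (map (\<lambda>M. M @ [3]) Ms)"
        using append_Cons_eq_iff2[of 3 A1 M] eq Cons.prems(2) by auto
      then have "(3 # A2) @ 3 # R @ 3 # B = 3 # concat (map (\<lambda>M. M @ [3]) Ms)" by simp
      then show ?thesis using Cons.IH[of "3 # A2"] Cons.prems(2) by auto
    qed
  qed
qed

text \<open>The conditions on words are read back as conditions on lists of symbols: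
  \<open>v\<close> is one block with its closing marker, and the only 2 in it separates the two
  components.\<close>

lemma in_word_blocksD:
  assumes in_word: "in_word (enc (blocks Ms)) u (enc Q)"
    and Ms: "\<And>M. M \<in> set Ms \<Longrightarrow> 3 \<notin> set M \<and> (\<exists>U' Q'. M = U' @ [2, 0] @ Q' \<and> 2 \<notin> set U' \<and> 2 \<notin> set Q')"
  shows "\<exists>U. u = enc U \<and> U @ [2, 0] @ Q \<in> set Ms"
proof -
  obtain p v where p: "prefix p (enc (blocks Ms))" "suffix (enc [0, 3] @ v) p"
    and u: "prefix (u @ enc [2]) v" "suffix [L1] u"
    and q: "suffix (enc [0, 2, 0] @ enc Q @ enc [3]) v"
    and last: "\<And>p'. prefix p' v \<Longrightarrow> suffix (enc [0, 3]) p' \<Longrightarrow> p' = v"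
    using in_word unfolding in_word_def by blast
  obtain U where U: "u = enc U" using suffix_L1_enc[OF u(2)] by blast
  obtain t where t: "v = t @ enc [0, 2, 0] @ enc Q @ enc [3]" using q by (auto simp: suffix_def)
  then have "v = (t @ enc [0, 2, 0] @ enc Q @ [L2, L2, L2]) @ [L1]" by simp
  then have "suffix [L1] v" unfolding suffix_def by blast
  then obtain V where V: "v = enc V" using suffix_L1_enc by blast
  obtain a b where ab: "enc (blocks Ms) = a @ enc [0, 3] @ enc V @ b"
    using p by (auto simp: prefix_def suffix_def V)
  then have "a @ L1 # ([L2, L2, L2, L1] @ enc V @ b) = enc (blocks Ms)" by (simp add: enc_03)
  \<comment> \<open>The \<open>L1\<close> of \<open>enc [0, 3]\<close> puts the cut between two
    symbols, so the marker is read as a whole symbol.\<close>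
  then obtain A B where AB: "blocks Ms = A @ B" "enc A = a @ [L1]" "enc B = [L2, L2, L2, L1] @ enc V @ b"
    using enc_split by blast
  then have "enc ([3] @ V) @ b = enc B" unfolding enc_append by simp
  then obtain B' where B': "B = 3 # V @ B'" using enc_prefixD[of "[3] @ V"] by auto
  obtain r where "v = (u @ enc [2]) @ r" using u(1) by (auto simp: prefix_def)
  then have "enc (U @ [2]) @ r = enc V" by (simp only: V U enc_append)
  then obtain V1 where V1: "V = U @ 2 # V1" using enc_prefixD[of "U @ [2]"] by auto
  have "t @ L1 # enc (2 # 0 # Q @ [3]) = enc V"
    using t V by (simp add: enc_020 enc_Cons enc_append numeral_eq_Suc)
  then obtain K1 K2 where K: "V = K1 @ K2" "enc K2 = enc (2 # 0 # Q @ [3])"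
    using enc_split by blast
  then have V2: "V = K1 @ 2 # 0 # Q @ [3]" by (simp add: enc_inj)
  have "A \<noteq> []" using AB(2) by auto
  then obtain A' where A': "A' @ 3 # V @ B' = 3 # concat (map (\<lambda>M. M @ [3]) Ms)"
    using AB(1) B' unfolding blocks_def by (cases A) auto
  define R where "R = K1 @ 2 # 0 # Q"
  have R: "V = R @ [3]" using V2 by (simp add: R_def)
  \<comment> \<open>A 3 at the front of \<open>R\<close> would make the empty list a block; one
    further on would close a proper prefix of \<open>v\<close> ending in
    \<open>enc [0, 3]\<close>.\<close>
  have "3 \<notin> set R"
  proof
    assume "3 \<in> set R"
    then obtain R1 R2 where R12: "R = R1 @ 3 # R2" by (meson split_list)
    show False
    proof (cases "R1 = []")
      case True
      then have "[] \<in> set Ms"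
        using blocks_memD[of A' "[]" "R2 @ [3] @ B'" Ms] A' Ms R R12 by simp
      then show False using Ms by auto
    next
      case False
      then obtain r where r: "enc R1 = r @ [L1]" using enc_last_L1 by blast
      have "suffix (enc [0, 3]) (enc (R1 @ [3]))" by (simp add: enc_append r enc_03 suffix_def)
      moreover have "prefix (enc (R1 @ [3])) v"
        unfolding V R R12 enc_append enc_Cons by (simp add: prefix_def enc_append enc_Cons)
      ultimately have "enc (R1 @ [3]) = enc V" using last V by blast
      then show False by (simp add: enc_inj R R12)
    qed
  qed
  then have mem: "R \<in> set Ms" using blocks_memD[of A' R B' Ms] A' R Ms by simp
  then obtain U' Q' where R': "R = U' @ [2, 0] @ Q'" "2 \<notin> set U'" "2 \<notin> set Q'" using Ms by blast
  then have eqs: "U' @ 2 # (0 # Q' @ [3]) = U @ 2 # V1" "U' @ 2 # (0 # Q' @ [3]) = K1 @ 2 # (0 # Q @ [3])"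
    using V1 V2 R by simp_all
  have two: "2 \<notin> set (0 # Q' @ [3])" using R'(3) by simp
  \<comment> \<open>The marker 2 occurs just once, so all splittings at it coincide.\<close>
  have "U = U'" "Q = Q'"
    using append_Cons_eq_iff[OF R'(2) two, THEN iffD1, OF eqs(1)]
      append_Cons_eq_iff[OF R'(2) two, THEN iffD1, OF eqs(2)] by auto
  then show ?thesis using mem R'(1) U by blast
qed

section \<open>The formula that interprets \<open>C\<close>\<close>

section \<open>Defining concatenation\<close>

lemma sat_Conj [simp]: "sat D F R e (Conj ps) \<longleftrightarrow> (\<forall>p\<in>set ps. sat D F R e p)"
  by (induction ps) (simp_all add: Conj_def)

lemma wf_connectives [simp]:
  "wf_fm L (And p q) \<longleftrightarrow> wf_fm L p \<and> wf_fm L q"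
  "wf_fm L (Or p q) \<longleftrightarrow> wf_fm L p \<and> wf_fm L q"
  "wf_fm L (Iff p q) \<longleftrightarrow> wf_fm L p \<and> wf_fm L q"
  "wf_fm L (Exists p) \<longleftrightarrow> wf_fm L p"
  by (auto simp: And_def Or_def Iff_def Exists_def)

lemma wf_Conj [simp]: "wf_fm L (Conj ps) \<longleftrightarrow> (\<forall>p\<in>set ps. wf_fm L p)"
  by (induction ps) (simp_all add: Conj_def)

lemma fv_connectives [simp]:
  "fv (Neg p) = fv p"
  "fv (And p q) = fv p \<union> fv q"
  "fv (Or p q) = fv p \<union> fv q"
  "fv (Iff p q) = fv p \<union> fv q"
  "fv (Exists p) = {i. Suc i \<in> fv p}"
  by (auto simp: Neg_def And_def Or_def Iff_def Exists_def)

lemma fv_subst_trm: "fv_trm (subst_trm \<sigma> t) = (\<Union>i\<in>fv_trm t. fv_trm (\<sigma> i))"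
  by (induction t) auto

lemma fv_push: "Suc i \<in> fv_trm (push \<sigma> j) \<Longrightarrow> \<exists>k. i \<in> fv_trm (\<sigma> k)"
  by (cases j) (auto simp: push_def fv_subst_trm)

lemma fv_subst: "i \<in> fv (subst \<sigma> p) \<Longrightarrow> \<exists>j. i \<in> fv_trm (\<sigma> j)"
proof (induction p arbitrary: \<sigma> i)
  case (Forall p)
  then obtain j where "Suc i \<in> fv_trm (push \<sigma> j)" by fastforce
  then show ?case by (rule fv_push)
qed (auto simp: fv_subst_trm)

text \<open>All indices from 2 on go to \<open>c\<close>, so the free variables of the result are
  bounded by those of the three terms, whatever \<open>p\<close> is.\<close>

definition at3 :: "('f, 'r) fm \<Rightarrow> 'f trm \<Rightarrow> 'f trm \<Rightarrow> 'f trm \<Rightarrow> ('f, 'r) fm" where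
  "at3 p a b c = subst (\<lambda>i. if i = 0 then a else if i = 1 then b else c) p"

lemma sat_at3: "sat D F R e (at3 p a b c) \<longleftrightarrow>
    sat D F R (\<lambda>i. if i = 0 then eval F e a else if i = 1 then eval F e b else eval F e c) p"
  unfolding at3_def sat_subst by (rule arg_cong[where f = "\<lambda>e. sat D F R e p"], rule ext) simp

lemma wf_at3: "wf_fm L p \<Longrightarrow> wf_trm L a \<Longrightarrow> wf_trm L b \<Longrightarrow> wf_trm L c \<Longrightarrow> wf_fm L (at3 p a b c)"
  unfolding at3_def by (rule wf_subst) simp_all

lemma fv_at3: "fv (at3 p a b c) \<subseteq> fv_trm a \<union> fv_trm b \<union> fv_trm c"
  unfolding at3_def by (auto dest!: fv_subst split: if_splits)

definition snocs :: "letter list \<Rightarrow> vw_fun trm \<Rightarrow> vw_fun trm" where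
  "snocs ds t = foldl (\<lambda>t d. snoc_trm d t) t ds"

definition conses :: "letter list \<Rightarrow> vw_fun trm \<Rightarrow> vw_fun trm" where
  "conses ds t = foldr (\<lambda>d t. cons_trm d t) ds t"

lemma vw_arities [simp]:
  "fun_arity vw_sig E = Some 0" "fun_arity vw_sig (snoc_sym d) = Some (Suc 0)"
  "fun_arity vw_sig (cons_sym d) = Some (Suc 0)" "rel_arity vw_sig r = Some 2"
  by (cases d; simp add: vw_sig_def snoc_sym_def cons_sym_def)+

lemma wf_snocs [simp]: "wf_trm vw_sig (snocs ds t) = wf_trm vw_sig t"
  unfolding snocs_def by (induction ds arbitrary: t) simp_all

lemma wf_conses [simp]: "wf_trm vw_sig (conses ds t) = wf_trm vw_sig t"
  unfolding conses_def by (induction ds) simp_all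

lemma canon_eq_snocs: "canon w = snocs w (Fun E [])"
  by (simp add: canon_def snocs_def)

lemma wf_canon [simp]: "wf_trm vw_sig (canon w)"
  by (simp add: canon_eq_snocs)

lemma fv_canon [simp]: "fv_trm (canon w) = {}"
  by (induction w rule: rev_induct) (simp_all add: canon_def)

lemma subst_canon [simp]: "subst_trm \<sigma> (canon w) = canon w"
  by (induction w rule: rev_induct) (simp_all add: canon_def)

text \<open>Free variables: \<open>w\<close>, \<open>u\<close>, \<open>q\<close>, as in \<^const>\<open>in_word\<close>.\<close>

definition in_fm :: "(vw_fun, vw_rel) fm" where
  "in_fm = Exists (And (Rel Pre [Var 0, Var 1]) (Exists (Conj
     [Rel Suf [Var 0, Var 1], Rel Suf [conses (enc [0, 3]) (Var 0), Var 1],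
      Rel Pre [Var 3, Var 0], Rel Pre [snocs (enc [2]) (Var 3), Var 0],
      Rel Suf [canon [L1], Var 3],
      Rel Suf [conses (enc [0, 2, 0]) (snocs (enc [3]) (Var 4)), Var 0],
      Forall (Imp (Rel Pre [Var 0, Var 1]) (Imp (Rel Suf [canon (enc [0, 3]), Var 0])
        (Eq (Var 0) (Var 1))))])))"

text \<open>Free variables: \<open>w\<close>, \<open>x\<close>, \<open>y\<close>.\<close>

definition good_fm :: "(vw_fun, vw_rel) fm" where
  "good_fm = And (at3 in_fm (Var 0) (Var 1) (canon [])) (Forall (Imp
     (And (Rel Pre [Var 0, Var 3]) (Rel Suf [canon [L1], cons_trm L1 (Var 0)]))
     (Forall (Imp (at3 in_fm (Var 2) (Var 0) (Var 1)) (Conj (map (\<lambda>n.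
        Imp (Rel Pre [snocs (enc [n]) (Var 1), Var 4])
          (at3 in_fm (Var 2) (snocs (enc [n]) (Var 0)) (snocs (enc [n]) (Var 1)))) [0, 1]))))))"

text \<open>Free variables: x, y, z. For standard codes x and y, no good w, even a nonstandard one,
  misses the true z, and a single standard good w rules out all others.\<close>

definition concat_fm :: "(vw_fun, vw_rel) fm" where
  "concat_fm = Forall (Imp (at3 good_fm (Var 0) (Var 1) (Var 2)) (at3 in_fm (Var 0) (Var 3) (Var 2)))"

definition unique_fm :: "(vw_fun, vw_rel) fm" where
  "unique_fm = Exists (Forall (Iff (at3 concat_fm (Var 2) (Var 3) (Var 0)) (Eq (Var 0) (Var 1))))"

text \<open>The default z = x makes this the graph of a total function on every model, since
  totality and functionality of \<open>C\<close> are demanded of all elements.\<close>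

definition C_fm :: "(vw_fun, vw_rel) fm" where
  "C_fm = Or (And (at3 unique_fm (Var 0) (Var 1) (Var 1)) (at3 concat_fm (Var 0) (Var 1) (Var 2)))
     (And (Neg (at3 unique_fm (Var 0) (Var 1) (Var 1))) (Eq (Var 2) (Var 0)))"

lemma wf_in_fm: "wf_fm vw_sig in_fm"
  by (simp add: in_fm_def)

lemma wf_good_fm: "wf_fm vw_sig good_fm"
  by (simp add: good_fm_def wf_at3 wf_in_fm)

lemma wf_concat_fm: "wf_fm vw_sig concat_fm"
  by (simp add: concat_fm_def wf_at3 wf_in_fm wf_good_fm)

lemma wf_C_fm: "wf_fm vw_sig C_fm"
  by (simp add: C_fm_def unique_fm_def wf_at3 wf_concat_fm)

lemma fv_C_fm: "fv C_fm \<subseteq> {..<3}"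
proof -
  have "fv (at3 p (Var 0) (Var 1) (Var i)) \<subseteq> {..<3}" if "i < 3" for p :: "(vw_fun, vw_rel) fm" and i
    using fv_at3[of p "Var 0" "Var 1" "Var i"] that by auto
  from this[of 1 unique_fm] this[of 2 concat_fm] show ?thesis by (simp add: C_fm_def)
qed

section \<open>Standard elements of a model, and the meaning of the formulas in it\<close>

locale vw_model =
  fixes D :: "'a set" and F :: "vw_fun \<Rightarrow> 'a list \<Rightarrow> 'a" and R :: "vw_rel \<Rightarrow> 'a list \<Rightarrow> bool"
    and e0 :: "nat \<Rightarrow> 'a"
  assumes struct: "structure_on vw_sig D F"
    and ax: "a \<in> vw_star_axioms \<Longrightarrow> sat D F R e0 a"
begin

text \<open>The values of the canonical terms are the standard elements; the model may contain
  further ones.\<close>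

definition c :: "letter list \<Rightarrow> 'a" where
  "c w = foldl (\<lambda>x d. F (snoc_sym d) [x]) (F E []) w"

lemma eval_canon [simp]: "eval F e (canon w) = c w"
  by (induction w rule: rev_induct) (simp_all add: canon_def c_def)

lemma c_snoc: "F (snoc_sym d) [c w] = c (w @ [d])"
  by (simp add: c_def)

lemma fun_closed: "fun_arity vw_sig f = Some 1 \<Longrightarrow> x \<in> D \<Longrightarrow> F f [x] \<in> D"
  using struct unfolding structure_on_def by simp

lemma c_closed [simp]: "c w \<in> D"
proof (induction w rule: rev_induct)
  case Nil
  have "F E [] \<in> D" using struct unfolding structure_on_def by simp
  then show ?case by (simp add: c_def)
next
  case (snoc d w)
  then show ?case by (simp add: c_snoc[symmetric] fun_closed)
qed

lemma c_inj [simp]: "c s = c t \<longleftrightarrow> s = t"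
proof -
  have "sat D F R e0 (Neg (Eq (canon s) (canon t)))" if "s \<noteq> t"
    by (rule ax) (use that in \<open>unfold vw_star_axioms_def, blast\<close>)
  then show ?thesis by auto
qed

lemma c_cons: "F (cons_sym d) [c w] = c (d # w)"
proof -
  have "sat D F R e0 (Eq (cons_trm d (canon w)) (canon (d # w)))"
    by (rule ax, unfold vw_star_axioms_def) blast
  then show ?thesis by simp
qed

text \<open>By induction on the last letter, the axioms list all prefixes of a standard word; in
  particular nothing nonstandard is among them.\<close>

lemma pre_iff: "x \<in> D \<Longrightarrow> R Pre [x, c w] \<longleftrightarrow> (\<exists>v. prefix v w \<and> x = c v)"
proof (induction w rule: rev_induct)
  case Nil
  have "sat D F R e0 (Rel Pre [canon [], canon []])"
    by (rule ax, unfold vw_star_axioms_def) blast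
  moreover have "sat D F R e0 (Forall (Imp (Rel Pre [Var 0, canon []]) (Eq (Var 0) (canon []))))"
    by (rule ax, unfold vw_star_axioms_def) blast
  ultimately show ?case using Nil by auto
next
  case (snoc d w)
  have "sat D F R e0 (Forall (Iff (Rel Pre [Var 0, snoc_trm d (canon w)])
        (Or (Rel Pre [Var 0, canon w]) (Eq (Var 0) (snoc_trm d (canon w))))))"
    by (rule ax, unfold vw_star_axioms_def) blast
  then have "R Pre [x, c (w @ [d])] \<longleftrightarrow> R Pre [x, c w] \<or> x = c (w @ [d])"
    using snoc.prems by (simp add: c_snoc)
  with snoc show ?case by auto
qed

text \<open>The mirror image, by induction on the first letter through the symbols \<open>S3\<close>
  and \<open>S4\<close>.\<close>

lemma suf_iff: "x \<in> D \<Longrightarrow> R Suf [x, c w] \<longleftrightarrow> (\<exists>v. suffix v w \<and> x = c v)"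
proof (induction w)
  case Nil
  have "sat D F R e0 (Rel Suf [canon [], canon []])"
    by (rule ax, unfold vw_star_axioms_def) blast
  moreover have "sat D F R e0 (Forall (Imp (Rel Suf [Var 0, canon []]) (Eq (Var 0) (canon []))))"
    by (rule ax, unfold vw_star_axioms_def) blast
  ultimately show ?case using Nil by auto
next
  case (Cons d w)
  have "sat D F R e0 (Forall (Iff (Rel Suf [Var 0, cons_trm d (canon w)])
        (Or (Rel Suf [Var 0, canon w]) (Eq (Var 0) (cons_trm d (canon w))))))"
    by (rule ax, unfold vw_star_axioms_def) blast
  then have "R Suf [x, c (d # w)] \<longleftrightarrow> R Suf [x, c w] \<or> x = c (d # w)"
    using Cons.prems by (simp add: c_cons)
  with Cons show ?case by (auto simp: suffix_Cons)
qed

lemma pre_c [simp]: "R Pre [c v, c w] \<longleftrightarrow> prefix v w"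
  by (auto simp: pre_iff)

lemma suf_c [simp]: "R Suf [c v, c w] \<longleftrightarrow> suffix v w"
  by (auto simp: suf_iff)

text \<open>Quantifiers bounded by a standard word reduce to quantifiers over actual words, which
  makes \<open>in_val\<close> absolute on standard elements.\<close>

lemma Bex_pre: "(\<exists>p\<in>D. R Pre [p, c w] \<and> P p) \<longleftrightarrow> (\<exists>p. prefix p w \<and> P (c p))"
  by (metis c_closed pre_iff)

lemma Ball_pre: "(\<forall>p\<in>D. R Pre [p, c w] \<longrightarrow> P p) \<longleftrightarrow> (\<forall>p. prefix p w \<longrightarrow> P (c p))"
  by (metis c_closed pre_iff)

lemma Bex_suf: "(\<exists>p\<in>D. R Suf [p, c w] \<and> P p) \<longleftrightarrow> (\<exists>p. suffix p w \<and> P (c p))"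
  by (metis c_closed suf_iff)

definition snocs_val :: "letter list \<Rightarrow> 'a \<Rightarrow> 'a" where
  "snocs_val ds x = foldl (\<lambda>x d. F (snoc_sym d) [x]) x ds"

definition conses_val :: "letter list \<Rightarrow> 'a \<Rightarrow> 'a" where
  "conses_val ds x = foldr (\<lambda>d x. F (cons_sym d) [x]) ds x"

lemma eval_snocs [simp]: "eval F e (snocs ds t) = snocs_val ds (eval F e t)"
  unfolding snocs_def snocs_val_def by (induction ds arbitrary: t) simp_all

lemma eval_conses [simp]: "eval F e (conses ds t) = conses_val ds (eval F e t)"
  unfolding conses_def conses_val_def by (induction ds) simp_all

lemma snocs_val_c [simp]: "snocs_val ds (c w) = c (w @ ds)"
  unfolding snocs_val_def by (induction ds arbitrary: w) (simp_all add: c_snoc)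

lemma conses_val_c [simp]: "conses_val ds (c w) = c (ds @ w)"
  unfolding conses_val_def by (induction ds) (simp_all add: c_cons)

definition in_val :: "'a \<Rightarrow> 'a \<Rightarrow> 'a \<Rightarrow> bool" where
  "in_val w u q \<longleftrightarrow> (\<exists>p\<in>D. R Pre [p, w] \<and> (\<exists>v\<in>D. R Suf [v, p] \<and>
     (R Suf [conses_val (enc [0, 3]) v, p] \<and> R Pre [u, v] \<and> R Pre [snocs_val (enc [2]) u, v] \<and>
      R Suf [c [L1], u] \<and> R Suf [conses_val (enc [0, 2, 0]) (snocs_val (enc [3]) q), v] \<and>
      (\<forall>p'\<in>D. R Pre [p', v] \<longrightarrow> R Suf [c (enc [0, 3]), p'] \<longrightarrow> p' = v))))"

lemma sat_in_fm: "sat D F R e in_fm \<longleftrightarrow> in_val (e 0) (e 1) (e 2)"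
  by (simp add: in_fm_def in_val_def del: enc_singletons)

lemma in_val_c: "in_val (c w) (c u) (c q) \<longleftrightarrow> in_word w u q"
  unfolding in_val_def Bex_pre Bex_suf Ball_pre in_word_def snocs_val_c conses_val_c pre_c suf_c c_inj
  by simp

text \<open>The bounds \<open>R Pre [p, w]\<close>, \<open>R Suf [v, p]\<close> and
  \<open>R Pre [u, v]\<close> serve this purpose: starting from a standard \<open>w\<close>, they
  make \<open>p\<close>, \<open>v\<close> and \<open>u\<close> standard in turn.\<close>

lemma in_val_D:
  assumes "in_val (c w) u (c q)" "u \<in> D"
  shows "\<exists>u'. u = c u' \<and> in_word w u' q"
proof -
  obtain v where "R Pre [u, c v]"
    using assms(1) unfolding in_val_def Bex_pre Bex_suf by blast
  then obtain u' where "u = c u'" using pre_iff assms(2) by blast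
  with assms(1) show ?thesis by (auto simp: in_val_c)
qed

definition good_val :: "'a \<Rightarrow> 'a \<Rightarrow> 'a \<Rightarrow> bool" where
  "good_val w x y \<longleftrightarrow> in_val w x (c []) \<and>
     (\<forall>q\<in>D. R Pre [q, y] \<longrightarrow> R Suf [c [L1], F (cons_sym L1) [q]] \<longrightarrow>
       (\<forall>u\<in>D. in_val w u q \<longrightarrow> (\<forall>n\<in>{0, 1}. R Pre [snocs_val (enc [n]) q, y] \<longrightarrow>
          in_val w (snocs_val (enc [n]) u) (snocs_val (enc [n]) q))))"

lemma sat_good_fm: "sat D F R e good_fm \<longleftrightarrow> good_val (e 0) (e 1) (e 2)"
  by (simp add: good_fm_def good_val_def sat_at3 sat_in_fm imp_conjL del: enc_singletons)

definition concat_val :: "'a \<Rightarrow> 'a \<Rightarrow> 'a \<Rightarrow> bool" where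
  "concat_val x y z \<longleftrightarrow> (\<forall>w\<in>D. good_val w x y \<longrightarrow> in_val w z y)"

lemma sat_concat_fm: "sat D F R e concat_fm \<longleftrightarrow> concat_val (e 0) (e 1) (e 2)"
  by (simp add: concat_fm_def concat_val_def sat_at3 sat_in_fm sat_good_fm)

definition C_val :: "'a \<Rightarrow> 'a \<Rightarrow> 'a \<Rightarrow> bool" where
  "C_val x y z \<longleftrightarrow> (let u = (\<exists>v\<in>D. \<forall>v'\<in>D. concat_val x y v' \<longleftrightarrow> v' = v) in
     u \<and> concat_val x y z \<or> \<not> u \<and> z = x)"

lemma sat_C_fm: "sat D F R e C_fm \<longleftrightarrow> C_val (e 0) (e 1) (e 2)"
  by (simp add: C_fm_def unique_fm_def C_val_def sat_at3 sat_concat_fm Let_def)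

lemma C_val_total: "x \<in> D \<Longrightarrow> \<exists>z\<in>D. C_val x y z"
  unfolding C_val_def Let_def by metis

lemma C_val_functional: "v \<in> D \<Longrightarrow> v' \<in> D \<Longrightarrow> C_val x y v \<Longrightarrow> C_val x y v' \<Longrightarrow> v = v'"
  unfolding C_val_def Let_def by metis

text \<open>Here \<open>w\<close> may be nonstandard. Only the closure steps along the standard list
  \<open>Q\<close> are followed, so ordinary induction suffices.\<close>

lemma good_val_reach:
  assumes "w \<in> D" and good: "good_val w (c (enc X)) (c (enc Y))" and Y: "set Y \<subseteq> {0, 1}"
  shows "prefix Q Y \<Longrightarrow> in_val w (c (enc (X @ Q))) (c (enc Q))"
proof (induction Q rule: rev_induct)
  case Nil
  then show ?case using good by (simp add: good_val_def)
next
  case (snoc n Q)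
  have "prefix Q Y" "n \<in> {0, 1}" using snoc.prems Y by (auto simp: prefix_def)
  moreover have "prefix (enc Q @ enc [n]) (enc Y)" "prefix (enc Q) (enc Y)"
    using snoc.prems \<open>prefix Q Y\<close> by (simp_all only: enc_append[symmetric] prefix_enc)
  \<comment> \<open>The \<open>L1\<close> put in front makes the test for codes accept the empty
    word too.\<close>
  moreover have "suffix [L1] (L1 # enc Q)"
    using enc_suffix_L1[of "0 # Q"] by (simp add: enc_Cons)
  moreover have step: "in_val w (snocs_val (enc [n]) u) (snocs_val (enc [n]) q)"
    if "q \<in> D" "R Pre [q, c (enc Y)]" "R Suf [c [L1], F (cons_sym L1) [q]]"
      "u \<in> D" "in_val w u q" "n \<in> {0, 1}" "R Pre [snocs_val (enc [n]) q, c (enc Y)]" for q u n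
    using good that unfolding good_val_def by blast
  ultimately have "in_val w (snocs_val (enc [n]) (c (enc (X @ Q)))) (snocs_val (enc [n]) (c (enc Q)))"
    using snoc.IH by (intro step) (simp_all del: enc_singletons add: c_cons)
  then show ?case by (simp add: enc_append del: enc_singletons)
qed

text \<open>The word has one block for each prefix \<open>Q\<close> of \<open>Y\<close>, pairing
  \<open>X @ Q\<close> with \<open>Q\<close>. These pairs are closed under the required steps, and
  only \<open>X @ Y\<close> is paired with \<open>Y\<close>.\<close>

lemma good_val_exists:
  assumes X: "set X \<subseteq> {0, 1}" "X \<noteq> []" and Y: "set Y \<subseteq> {0, 1}"
  shows "\<exists>w. good_val (c w) (c (enc X)) (c (enc Y)) \<and>
    (\<forall>z\<in>D. in_val (c w) z (c (enc Y)) \<longrightarrow> z = c (enc (X @ Y)))"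
proof -
  define Ms where "Ms = map (\<lambda>Q. (X @ Q) @ [2, 0] @ Q) (prefixes Y)"
  let ?w = "enc (blocks Ms)"
  have bits: "set Q \<subseteq> {0, 1}" if "prefix Q Y" for Q
    using that Y by (auto simp: prefix_def)
  have mem: "M \<in> set Ms \<longleftrightarrow> (\<exists>Q. prefix Q Y \<and> M = (X @ Q) @ [2, 0] @ Q)" for M
    by (auto simp: Ms_def)
  have in_w: "in_word ?w (enc (X @ Q)) (enc Q)" if "prefix Q Y" for Q
  proof (rule in_word_blocksI)
    show "(X @ Q) @ [2, 0] @ Q \<in> set Ms" using that mem by blast
    show "3 \<notin> set (X @ Q)" "3 \<notin> set Q" "X @ Q \<noteq> []" using bits[OF that] X by auto
  qed
  have blk: "3 \<notin> set M \<and> (\<exists>U' Q'. M = U' @ [2, 0] @ Q' \<and> 2 \<notin> set U' \<and> 2 \<notin> set Q')"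
    if M: "M \<in> set Ms" for M
  proof -
    obtain Q where Q: "prefix Q Y" "M = (X @ Q) @ [2, 0] @ Q"
      using M mem by blast
    have "2 \<notin> set (X @ Q)" "2 \<notin> set Q" "3 \<notin> set (X @ Q)"
      using bits[OF Q(1)] X(1) by auto
    then have "3 \<notin> set M" unfolding Q(2) by simp
    show ?thesis by (intro conjI exI[of _ "X @ Q"] exI[of _ Q]) fact+
  qed
  \<comment> \<open>An arbitrary element \<open>u\<close> of the model is first shown standard by
    \<open>in_val_D\<close>; then the single marker 2 identifies its block.\<close>
  have in_w_D: "u = c (enc (X @ Q)) \<and> prefix Q Y"
    if in_val: "in_val (c ?w) u (c (enc Q))" and "u \<in> D" and "set Q \<subseteq> {0, 1}" for u Q
  proof -
    obtain u' where u': "u = c u'" "in_word ?w u' (enc Q)" using in_val_D[OF in_val \<open>u \<in> D\<close>] by blast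
    then obtain U where U: "u' = enc U" "U @ [2, 0] @ Q \<in> set Ms" using in_word_blocksD blk by blast
    then obtain Q' where Q': "prefix Q' Y" "U @ 2 # 0 # Q = (X @ Q') @ 2 # 0 # Q'"
      using mem by auto
    have two: "2 \<notin> set (X @ Q')" "2 \<notin> set (0 # Q')" using bits[OF Q'(1)] X by auto
    have "X @ Q' = U \<and> 0 # Q' = 0 # Q"
      using append_Cons_eq_iff[OF two, THEN iffD1, OF Q'(2)[symmetric]] .
    then show ?thesis using u' U Q'(1) by auto
  qed
  have "good_val (c ?w) (c (enc X)) (c (enc Y))"
    unfolding good_val_def
  proof (intro conjI ballI impI)
    show "in_val (c ?w) (c (enc X)) (c [])" using in_w[of "[]"] by (simp add: in_val_c)
    fix q u n
    assume q: "q \<in> D" "R Pre [q, c (enc Y)]" "R Suf [c [L1], F (cons_sym L1) [q]]"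
      and u: "u \<in> D" "in_val (c ?w) u q"
      and n: "n \<in> {0, 1 :: nat}" "R Pre [snocs_val (enc [n]) q, c (enc Y)]"
    obtain q0 where q0: "q = c q0" "prefix q0 (enc Y)" using q pre_iff by blast
    have "suffix [L1] (L1 # q0)" using q(3) by (simp add: q0 c_cons)
    then have "q0 = [] \<or> suffix [L1] q0" by (auto simp: suffix_Cons)
    \<comment> \<open>A word that is empty or ends in \<open>L1\<close> is a code.\<close>
    then obtain Q where Q: "q0 = enc Q" using suffix_L1_enc enc_Nil by metis
    have pre: "prefix (Q @ [n]) Y"
      using n(2) by (simp only: q0 Q snocs_val_c pre_c enc_append[symmetric] prefix_enc)
    then have "set Q \<subseteq> {0, 1}" using bits[OF pre] by simp
    then have "u = c (enc (X @ Q))" using in_w_D[of u Q] u q0 Q by simp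
    then have "snocs_val (enc [n]) u = c (enc (X @ Q @ [n]))"
      by (simp add: enc_append del: enc_singletons)
    moreover have "snocs_val (enc [n]) q = c (enc (Q @ [n]))"
      by (simp add: q0 Q enc_append del: enc_singletons)
    ultimately show "in_val (c ?w) (snocs_val (enc [n]) u) (snocs_val (enc [n]) q)"
      using in_w[OF pre] by (simp add: in_val_c del: enc_singletons)
  qed
  moreover have "z = c (enc (X @ Y))" if "z \<in> D" "in_val (c ?w) z (c (enc Y))" for z
    using in_w_D[OF that(2,1) Y] by blast
  ultimately show ?thesis by blast
qed

text \<open>By \<open>good_val_reach\<close> the true value is in every good \<open>w\<close>, and
  the word from \<open>good_val_exists\<close> excludes all others, so the first case of
  \<open>C_val\<close> applies. \<open>X\<close> is nonempty because first components must end in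
  \<open>L1\<close>.\<close>

lemma C_val_c:
  assumes "set X \<subseteq> {0, 1}" "X \<noteq> []" "set Y \<subseteq> {0, 1}"
  shows "C_val (c (enc X)) (c (enc Y)) (c (enc (X @ Y)))"
proof -
  have "concat_val (c (enc X)) (c (enc Y)) z \<longleftrightarrow> z = c (enc (X @ Y))" if "z \<in> D" for z
  proof
    assume "concat_val (c (enc X)) (c (enc Y)) z"
    then show "z = c (enc (X @ Y))"
      using good_val_exists[OF assms] that unfolding concat_val_def by (meson c_closed)
  next
    assume "z = c (enc (X @ Y))"
    then show "concat_val (c (enc X)) (c (enc Y)) z"
      unfolding concat_val_def using good_val_reach[OF _ _ assms(3), of _ X Y] by auto
  qed
  then show ?thesis unfolding C_val_def Let_def using c_closed by metis
qed

end

section \<open>The translation and the validity of the translated axioms\<close>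

section \<open>The interpretation\<close>

lemma vw_axioms_wf: "a \<in> vw_star_axioms \<Longrightarrow> wf_fm vw_sig a"
  unfolding vw_star_axioms_def by auto

lemma vw_axioms_closed: "a \<in> vw_star_axioms \<Longrightarrow> fv a = {}"
  unfolding vw_star_axioms_def by auto

instance vw_fun :: countable by countable_datatype
instance vw_rel :: countable by countable_datatype

text \<open>Every provability claim about the interpretation is reduced by this to truth in all
  models.\<close>

lemma vw_completeness:
  assumes "wf_fm vw_sig p"
    and "\<And>D F R e. vw_model (D :: vw_fun trm set set) F R e \<Longrightarrow> (\<And>i. e i \<in> D) \<Longrightarrow> sat D F R e p"
  shows "proves vw_sig vw_star_axioms p"
  by (rule completeness)
    (use assms vw_axioms_wf vw_axioms_closed in \<open>auto simp: vw_model_def\<close>)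

lemma wf_funpow_Exists [simp]: "wf_fm L ((Exists ^^ n) p) = wf_fm L p"
  by (induction n) simp_all

lemma wf_with_values:
  assumes "wf_fm M (dom_fm \<tau>)" and "\<And>v. v \<in> set vs \<Longrightarrow> wf_fm M v" and "wf_fm M p"
  shows "wf_fm M (with_values \<tau> k vs p)"
  using assms by (auto simp: with_values_def Let_def dom_at_def intro!: wf_subst split: nat.split)

lemma wf_value_fm:
  assumes "wf_translation M L \<tau>" shows "wf_trm L t \<Longrightarrow> wf_fm M (value_fm \<tau> t)"
proof (induction t)
  case (Fun f ts)
  then show ?case
    using assms
    by (auto simp: wf_translation_def list_all_iff intro!: wf_with_values wf_subst split: nat.split)
qed simp

lemma wf_translate:
  assumes "wf_translation M L \<tau>" shows "wf_fm L p \<Longrightarrow> wf_fm M (translate \<tau> p)"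
proof (induction p)
  case (Eq s t)
  then show ?case
    using assms wf_value_fm[OF assms] by (auto simp: wf_translation_def intro!: wf_with_values)
next
  case (Rel r ts)
  then show ?case
    using assms wf_value_fm[OF assms]
    by (auto simp: wf_translation_def list_all_iff intro!: wf_with_values)
qed (use assms in \<open>auto simp: wf_translation_def\<close>)

definition code :: "bit list \<Rightarrow> nat list" where
  "code = map (case_bit 0 1)"

lemma code_bits: "set (code s) \<subseteq> {0, 1}"
  by (auto simp: code_def split: bit.split)

lemma code_append: "code (s @ t) = code s @ code t"
  by (simp add: code_def)

lemma code_Nil_iff [simp]: "code s = [] \<longleftrightarrow> s = []"
  by (simp add: code_def)

lemma code_inj [simp]: "code s = code t \<longleftrightarrow> s = t"
  unfolding code_def by (rule inj_map_eq_map) (auto simp: inj_def split: bit.splits)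

lemma prefix_code: "prefix ns (code t) \<longleftrightarrow> (\<exists>s. prefix s t \<and> ns = code s)"
  by (auto simp: prefix_def code_def map_eq_append_conv)

text \<open>The domain is everything. In \<open>Below\<close>, the suffix \<open>[L1]\<close>
  selects the nonempty prefixes that end at a block boundary, matching the absence of an empty
  string.\<close>

definition wd_translation :: "(bit list, wd_rel, vw_fun, vw_rel) translation" where
  "wd_translation = \<lparr>dom_fm = Eq (Var 0) (Var 0),
     fun_fm = (\<lambda>s. Eq (Var 0) (canon (enc (code s)))),
     rel_fm = (\<lambda>r. case r of
         Below \<Rightarrow> And (Rel Pre [Var 0, Var 1]) (Rel Suf [canon [L1], Var 0])
       | C \<Rightarrow> C_fm)\<rparr>"

lemma wd_translation_simps [simp]:
  "dom_fm wd_translation = Eq (Var 0) (Var 0)"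
  "fun_fm wd_translation s = Eq (Var 0) (canon (enc (code s)))"
  "rel_fm wd_translation Below = And (Rel Pre [Var 0, Var 1]) (Rel Suf [canon [L1], Var 0])"
  "rel_fm wd_translation C = C_fm"
  by (simp_all add: wd_translation_def)

lemma dom_at_wd [simp]: "dom_at wd_translation i = Eq (Var i) (Var i)"
  by (simp add: dom_at_def)

lemma wf_wd_translation: "wf_translation vw_sig wd_sig wd_translation"
  using wf_C_fm fv_C_fm
  by (auto simp: wf_translation_def wd_sig_def split: wd_rel.split)

lemma wf_Disj: "(\<And>p. p \<in> set ps \<Longrightarrow> wf_fm L p) \<Longrightarrow> wf_fm L (Disj ps)"
  by (induction ps) (simp_all add: Disj_def)

lemma wd_axioms_wf: "a \<in> wd_axioms \<Longrightarrow> wf_fm wd_sig a"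
  unfolding wd_axioms_def
  by (auto simp: wd_sig_def numeral_eq_Suc intro!: wf_Disj)

lemma translate_connectives [simp]:
  "translate \<tau> (Neg p) = Neg (translate \<tau> p)"
  "translate \<tau> (And p q) = And (translate \<tau> p) (translate \<tau> q)"
  "translate \<tau> (Or p q) = Or (translate \<tau> p) (translate \<tau> q)"
  "translate \<tau> (Iff p q) = Iff (translate \<tau> p) (translate \<tau> q)"
  by (simp_all add: Neg_def And_def Or_def Iff_def)

lemma sat_translate_Disj [simp]:
  "sat D F R e (translate \<tau> (Disj ps)) \<longleftrightarrow> (\<exists>p\<in>set ps. sat D F R e (translate \<tau> p))"
  by (induction ps) (simp_all add: Disj_def)

context vw_model
begin

primrec wd_val :: "(nat \<Rightarrow> 'a) \<Rightarrow> bit list trm \<Rightarrow> 'a" where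
  "wd_val e (Var i) = e i"
| "wd_val e (Fun s ts) = c (enc (code s))"

text \<open>Variables and constants are the terms that occur in the axioms of \<open>WD_R\<close>;
  on them \<open>value_fm\<close> unfolds without quantifiers.\<close>

fun simple :: "bit list trm \<Rightarrow> bool" where
  "simple (Var i) = True"
| "simple (Fun s []) = True"
| "simple _ = False"

lemma sat_value_fm:
  "simple t \<Longrightarrow> sat D F R e (value_fm wd_translation t) \<longleftrightarrow> e 0 = wd_val (\<lambda>i. e (Suc i)) t"
  by (cases t rule: simple.cases) (simp_all add: with_values_def sat_subst Conj_def)

lemma wd_val_closed: "(\<And>i. e i \<in> D) \<Longrightarrow> wd_val e t \<in> D"
  by (cases t) simp_all

text \<open>The equations for the term values determine the elements quantified by
  \<open>with_values\<close>, and these values lie in the domain.\<close>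

lemma sat_translate_Eq:
  assumes "simple s" "simple t" "\<And>i. e i \<in> D"
  shows "sat D F R e (translate wd_translation (Eq s t)) \<longleftrightarrow> wd_val e s = wd_val e t"
  using assms wd_val_closed[of e]
  by (auto simp: with_values_def sat_subst sat_value_fm numeral_eq_Suc)

lemma sat_translate_Below:
  assumes "simple s" "simple t" "\<And>i. e i \<in> D"
  shows "sat D F R e (translate wd_translation (Rel Below [s, t])) \<longleftrightarrow>
    R Pre [wd_val e s, wd_val e t] \<and> R Suf [c [L1], wd_val e s]"
  using assms wd_val_closed[of e]
  by (auto simp: with_values_def sat_subst sat_value_fm numeral_eq_Suc)

lemma sat_translate_C:
  assumes "simple r" "simple s" "simple t" "\<And>i. e i \<in> D"
  shows "sat D F R e (translate wd_translation (Rel C [r, s, t])) \<longleftrightarrow>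
    C_val (wd_val e r) (wd_val e s) (wd_val e t)"
  using assms wd_val_closed[of e]
  by (auto simp: with_values_def sat_subst sat_value_fm sat_C_fm numeral_eq_Suc)

lemma env_closed: "d \<in> D \<Longrightarrow> (\<And>i. e i \<in> D) \<Longrightarrow> case_nat d e i \<in> D"
  by (simp split: nat.split)

lemma sat_translate_Forall:
  "sat D F R e (translate wd_translation (Forall p)) \<longleftrightarrow>
    (\<forall>d\<in>D. sat D F R (case_nat d e) (translate wd_translation p))"
  by simp

lemma sat_translate_Exists:
  "sat D F R e (translate wd_translation (Exists p)) \<longleftrightarrow>
    (\<exists>d\<in>D. sat D F R (case_nat d e) (translate wd_translation p))"
  by (simp add: Exists_def)

lemmas sat_translate = sat_translate_Forall sat_translate_Exists sat_translate_Eq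
  sat_translate_Below sat_translate_C

text \<open>A prefix ending in \<open>L1\<close> is itself a code, and on codes of bit strings the
  prefix order is that of the strings.\<close>

lemma below_iff:
  assumes "x \<in> D"
  shows "R Pre [x, c (enc (code t))] \<and> R Suf [c [L1], x] \<longleftrightarrow>
    (\<exists>s. s \<noteq> [] \<and> prefix s t \<and> x = c (enc (code s)))" (is "?L \<longleftrightarrow> ?R")
proof
  assume L: ?L
  then obtain v where v: "x = c v" "prefix v (enc (code t))" using assms pre_iff by blast
  then have suf: "suffix [L1] v" using L by simp
  then obtain ns where ns: "v = enc ns" using suffix_L1_enc by blast
  then obtain s where "prefix s t" "ns = code s" using v(2) prefix_enc prefix_code by auto
  moreover have "ns \<noteq> []" using suf ns by auto
  ultimately show ?R using v(1) ns by auto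
next
  assume ?R
  then obtain s where s: "s \<noteq> []" "prefix s t" "x = c (enc (code s))" by blast
  then have "suffix [L1] (enc (code s))" by (simp add: enc_suffix_L1)
  with s show ?L by (auto simp: prefix_enc prefix_code)
qed

text \<open>Values of \<open>C\<close> at constants come from \<open>C_val_c\<close>, distinctness
  from injectivity of the coding, \<open>Below\<close> from \<open>below_iff\<close>. The last two
  axioms concern all elements and rest on the default built into \<open>C_val\<close>.\<close>

lemma wd_axioms_valid:
  assumes e: "\<And>i. e i \<in> D" and p: "p \<in> wd_axioms"
  shows "sat D F R e (translate wd_translation p)"
  using p unfolding wd_axioms_def
proof (elim UnE CollectE exE conjE singletonE)
  fix s t :: "bit list" assume "p = Rel C [wd_const s, wd_const t, wd_const (s @ t)]" "s \<noteq> []"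
  then show ?thesis
    using C_val_c[OF code_bits, of s "code t"] code_bits e
    by (simp add: sat_translate code_append del: translate.simps)
next
  fix s t assume "p = Neg (Eq (wd_const s) (wd_const t))" "s \<noteq> t"
  then show ?thesis using e by (simp add: sat_translate enc_inj del: translate.simps)
next
  fix t assume "p = Forall (Iff (Rel Below [Var 0, wd_const t])
    (Disj (map (\<lambda>s. Eq (Var 0) (wd_const s)) (filter (\<lambda>s. s \<noteq> []) (prefixes t)))))"
  then show ?thesis
    using below_iff[of _ t] env_closed e
    by (auto simp add: sat_translate simp del: translate.simps)
next
  assume "p = Forall (Forall (Exists (Rel C [Var 2, Var 1, Var 0])))"
  then show ?thesis
    using C_val_total env_closed e
    by (simp add: sat_translate numeral_eq_Suc del: translate.simps)
next
  assume "p = Forall (Forall (Forall (Forall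
    (Imp (And (Rel C [Var 3, Var 2, Var 1]) (Rel C [Var 3, Var 2, Var 0])) (Eq (Var 1) (Var 0))))))"
  then show ?thesis
    using C_val_functional env_closed e
    by (simp add: sat_translate numeral_eq_Suc del: translate.simps(1,2,3,5)) blast
qed

lemma constant_denotes:
  "sat D F R e (Exists1 (And (Eq (Var 0) (Var 0)) (Eq (Var 0) (canon w))))"
  by (simp add: Exists1_def sat_subst)

end

theorem theorem6p19: "interprets VW_star WD_R"
proof -
  have "interpretation_in VW_star WD_R wd_translation"
    unfolding interpretation_in_def VW_star_def WD_R_def fo_theory.simps
  proof (intro conjI allI impI ballI)
    show "wf_translation vw_sig wd_sig wd_translation" by (rule wf_wd_translation)
    show "proves vw_sig vw_star_axioms (Exists (dom_fm wd_translation))"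
      by (rule vw_completeness) auto
  next
    fix s n assume "fun_arity wd_sig s = Some n"
    \<comment> \<open>All function symbols are constants, so it remains to see that a canonical term
      has exactly one value.\<close>
    then have n: "n = 0" by (simp add: wd_sig_def split: if_splits)
    show "proves vw_sig vw_star_axioms ((Forall ^^ n) (Imp (Conj (map (dom_at wd_translation) [0..<n]))
        (Exists1 (And (dom_fm wd_translation) (fun_fm wd_translation s)))))"
    proof (rule vw_completeness)
      show "wf_fm vw_sig ((Forall ^^ n) (Imp (Conj (map (dom_at wd_translation) [0..<n]))
          (Exists1 (And (dom_fm wd_translation) (fun_fm wd_translation s)))))"
        by (auto simp: n Exists1_def intro!: wf_subst split: nat.split)
    qed (simp add: n vw_model.constant_denotes)
  next
    fix p assume p: "p \<in> wd_axioms"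
    show "proves vw_sig vw_star_axioms (translate wd_translation p)"
    proof (rule vw_completeness)
      show "wf_fm vw_sig (translate wd_translation p)"
        by (rule wf_translate[OF wf_wd_translation wd_axioms_wf[OF p]])
    qed (rule vw_model.wd_axioms_valid[OF _ _ p])
  qed
  then show ?thesis unfolding interprets_def by blast
qed

end
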